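(* Let $\mathbb{P}\mathrm{iez}$ be the space of 2D piezoelectricity tensors and write $\mathbf{P}=(\boldsymbol{v},\boldsymbol{w},\mathbf{H})$ with $\boldsymbol{v},\boldsymbol{w}\in\mathbb{H}^1(\mathbb{R}^2)$, $\mathbf{H}\in\mathbb{H}^3(\mathbb{R}^2)$, in a fixed explicit harmonic decomposition $\mathbb{P}\mathrm{iez}\simeq2\mathbb{H}^1(\mathbb{R}^2)\oplus\mathbb{H}^3(\mathbb{R}^2)$. (1) A minimal integrity basis of $\mathrm{Cov}(\mathbb{P}\mathrm{iez},\mathrm{SO}(2))$ consists of the following $30$ covariants ($13$ invariants): order 0: $\boldsymbol{v}\cdot\boldsymbol{v}$, $\boldsymbol{w}\cdot\boldsymbol{w}$, $\boldsymbol{v}\cdot\boldsymbol{w}$, $\boldsymbol{v}\times\boldsymbol{w}$, $\mathbf{H}\,\vdots\,\mathbf{H}$, $(\boldsymbol{v}\cdot\mathbf{H}\cdot\boldsymbol{v})\cdot\boldsymbol{v}$, $(\boldsymbol{v}\cdot\mathbf{H}\cdot\boldsymbol{v})\cdot\boldsymbol{w}$, $(\boldsymbol{w}\cdot\mathbf{H}\cdot\boldsymbol{w})\cdot\boldsymbol{w}$, $(\boldsymbol{w}\cdot\mathbf{H}\cdot\boldsymbol{w})\cdot\boldsymbol{v}$, $(\boldsymbol{v}\cdot\mathbf{H}\cdot\boldsymbol{v})\cdot(\mathbf{1}\times\boldsymbol{v})$, $(\boldsymbol{v}\cdot\mathbf{H}\cdot\boldsymbol{v})\cdot(\mathbf{1}\times\boldsymbol{w})$,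 $(\boldsymbol{w}\cdot\mathbf{H}\cdot\boldsymbol{w})\cdot(\mathbf{1}\times\boldsymbol{v})$, $(\boldsymbol{w}\cdot\mathbf{H}\cdot\boldsymbol{w})\cdot(\mathbf{1}\times\boldsymbol{w})$; order 1: $\boldsymbol{v}$, $\boldsymbol{w}$, $\mathbf{1}\times\boldsymbol{v}$, $\mathbf{1}\times\boldsymbol{w}$, $\boldsymbol{v}\cdot\mathbf{H}\cdot\boldsymbol{v}$, $\boldsymbol{w}\cdot\mathbf{H}\cdot\boldsymbol{w}$, $\boldsymbol{v}\cdot\mathbf{H}\cdot\boldsymbol{w}$, $\boldsymbol{v}\cdot\mathbf{H}\cdot(\mathbf{1}\times\boldsymbol{v})$, $\boldsymbol{w}\cdot\mathbf{H}\cdot(\mathbf{1}\times\boldsymbol{w})$, $\boldsymbol{v}\cdot\mathbf{H}\cdot(\mathbf{1}\times\boldsymbol{w})$; order 2: $\mathbf{1}$, $\mathbf{H}\cdot\boldsymbol{v}$, $\mathbf{H}\cdot\boldsymbol{w}$, $\mathbf{H}\cdot(\mathbf{1}\times\boldsymbol{v})$, $\mathbf{H}\cdot(\mathbf{1}\times\boldsymbol{w})$; order 3: $\mathbf{H}$, $\mathbf{1}\times\mathbf{H}$. (2) A minimal integrity basis of $\mathrm{Cov}(\mathbb{P}\mathrm{iez},\mathrm{O}(2))$ consists of the following $17$ covariants ($8$ invariants): order 0: $\boldsymbol{v}\cdot\boldsymbol{v}$, $\boldsymbol{w}\cdot\boldsymbol{w}$, $\boldsymbol{v}\cdot\boldsymbol{w}$,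 $\mathbf{H}\,\vdots\,\mathbf{H}$, $(\boldsymbol{v}\cdot\mathbf{H}\cdot\boldsymbol{v})\cdot\boldsymbol{v}$, $(\boldsymbol{v}\cdot\mathbf{H}\cdot\boldsymbol{v})\cdot\boldsymbol{w}$, $(\boldsymbol{w}\cdot\mathbf{H}\cdot\boldsymbol{w})\cdot\boldsymbol{w}$, $(\boldsymbol{w}\cdot\mathbf{H}\cdot\boldsymbol{w})\cdot\boldsymbol{v}$; order 1: $\boldsymbol{v}$, $\boldsymbol{w}$, $\boldsymbol{v}\cdot\mathbf{H}\cdot\boldsymbol{v}$, $\boldsymbol{w}\cdot\mathbf{H}\cdot\boldsymbol{w}$, $\boldsymbol{v}\cdot\mathbf{H}\cdot\boldsymbol{w}$; order 2: $\mathbf{1}$, $\mathbf{H}\cdot\boldsymbol{v}$, $\mathbf{H}\cdot\boldsymbol{w}$; order 3: $\mathbf{H}$.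
   Context: $\mathbb{P}\mathrm{iez}$ is the space of third-order tensors on $\mathbb{R}^2$ with $P_{ijk}=P_{ikj}$, with the standard tensorial action of $\mathrm{O}(2)$. $\mathbb{H}^n(\mathbb{R}^2)$ is the space of totally symmetric traceless tensors of order $n$ ($\mathbb{H}^1=\mathbb{R}^2$) with its tensorial action. An explicit harmonic decomposition is a choice of $\mathrm{O}(2)$-equivariant linear isomorphism with the indicated direct sum. $\mathrm{Inv}(\mathbb{V},G)$ is the algebra of $G$-invariant real polynomials on $\mathbb{V}$; $\mathrm{Cov}(\mathbb{V},G):=\mathrm{Inv}(\mathbb{V}\oplus\mathbb{R}^2,G)$ with the standard action on $\mathbf{x}=(x,y)\in\mathbb{R}^2$. A tensor-valued polynomial covariant $\mathbf{c}$ with values in totally symmetric tensors of order $o$ is identified with the element $\mathbf{c}(\mathbf{x},\dots,\mathbf{x})$ of $\mathrm{Cov}$; the order is the degree in $\mathbf{x}$; invariants are the covariants of order $0$. An integrity basis is a finite set of homogeneous generators; it is minimal if no proper subset generates. Dots denote contractions of one index: $(\boldsymbol{v}\cdot\mathbf{H}\cdot\boldsymbol{w})_j=v_iH_{ijk}w_k$, $(\mathbf{H}\cdot\boldsymbol{v})_{ij}=H_{ijk}v_k$; $\mathbf{H}\,\vdots\,\mathbf{H}=H_{ijk}H_{ijk}$. $\mathbf{1}$ is the identity second-order tensor. For totally symmetric tensors, $\mathbf{S}_1\times\mathbf{S}_2=-(\mathbf{S}_1\cdot\boldsymbol{\varepsilon}\cdot\mathbf{S}_2)^s$, with $\boldsymbol{\varepsilon}$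 the Levi-Civita tensor ($\varepsilon_{12}=1$) and $(\cdot)^s$ total symmetrization. *)

theory Defs
  imports "HOL-Analysis.Analysis"
begin

type_synonym vec2 = "real^2"
type_synonym ten2 = "real^2^2"
type_synonym ten3 = "real^2^2^2"

section \<open>Polynomial invariants and covariants\<close>

text \<open>A representation lives on a linear subspace \<open>V\<close> of a normed space. A polynomial on \<open>V\<close>
  is the restriction to \<open>V\<close> of a polynomial function of the ambient space; functions on
  \<open>V\<close> are extensional (\<^const>\<open>undefined\<close> outside \<open>V\<close>), so that equality is equality on \<open>V\<close>.\<close>

definition poly_funs :: "'a::real_normed_vector set \<Rightarrow> ('a \<Rightarrow> real) set" where
  "poly_funs V = {restrict p V | p. real_polynomial_function p}"

definition Inv ::
  "'g set \<Rightarrow> ('g \<Rightarrow> 'a \<Rightarrow> 'a) \<Rightarrow> 'a::real_normed_vector set \<Rightarrow> ('a \<Rightarrow> real) set" where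
  "Inv G act V = {f \<in> poly_funs V. \<forall>g\<in>G. \<forall>a\<in>V. f (act g a) = f a}"

definition Cov ::
  "ten2 set \<Rightarrow> (ten2 \<Rightarrow> 'a \<Rightarrow> 'a) \<Rightarrow> 'a::real_normed_vector set \<Rightarrow> ('a \<times> vec2 \<Rightarrow> real) set" where
  "Cov G act V = Inv G (\<lambda>g (a, x). (act g a, g *v x)) (V \<times> UNIV)"

inductive_set generated_algebra :: "'a set \<Rightarrow> ('a \<Rightarrow> real) set \<Rightarrow> ('a \<Rightarrow> real) set"
  for V :: "'a set" and B :: "('a \<Rightarrow> real) set" where
  const: "(\<lambda>a\<in>V. c) \<in> generated_algebra V B"
| gen: "f \<in> B \<Longrightarrow> f \<in> generated_algebra V B"
| add: "f \<in> generated_algebra V B \<Longrightarrow> g \<in> generated_algebra V B \<Longrightarrow>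
    (\<lambda>a\<in>V. f a + g a) \<in> generated_algebra V B"
| mult: "f \<in> generated_algebra V B \<Longrightarrow> g \<in> generated_algebra V B \<Longrightarrow>
    (\<lambda>a\<in>V. f a * g a) \<in> generated_algebra V B"

definition homogeneous_on :: "'a::real_vector set \<Rightarrow> ('a \<Rightarrow> real) \<Rightarrow> bool" where
  "homogeneous_on V f \<longleftrightarrow> (\<exists>d::nat. \<forall>t. \<forall>a\<in>V. f (t *\<^sub>R a) = t ^ d * f a)"

text \<open>\<open>A\<close> is the algebra (of functions on \<open>V\<close>) to be generated.\<close>

definition integrity_basis ::
  "'a::real_vector set \<Rightarrow> ('a \<Rightarrow> real) set \<Rightarrow> ('a \<Rightarrow> real) set \<Rightarrow> bool" where
  "integrity_basis V A B \<longleftrightarrow>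
     finite B \<and> B \<subseteq> A \<and> (\<forall>f\<in>B. homogeneous_on V f) \<and> generated_algebra V B = A"

definition minimal_integrity_basis ::
  "'a::real_vector set \<Rightarrow> ('a \<Rightarrow> real) set \<Rightarrow> ('a \<Rightarrow> real) set \<Rightarrow> bool" where
  "minimal_integrity_basis V A B \<longleftrightarrow>
     integrity_basis V A B \<and> (\<forall>B'. B' \<subset> B \<longrightarrow> generated_algebra V B' \<noteq> A)"

definition has_order :: "'a set \<Rightarrow> nat \<Rightarrow> ('a \<times> vec2 \<Rightarrow> real) \<Rightarrow> bool" where
  "has_order V n c \<longleftrightarrow> (\<forall>a\<in>V. \<forall>x t. c (a, t *\<^sub>R x) = t ^ n * c (a, x))"

section \<open>Piezoelectricity tensors and harmonic decompositions\<close>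

definition O2 :: "ten2 set" where
  "O2 = {g. orthogonal_matrix g}"

definition SO2 :: "ten2 set" where
  "SO2 = {g. orthogonal_matrix g \<and> det g = 1}"

definition tensor_act :: "ten2 \<Rightarrow> ten3 \<Rightarrow> ten3" where
  "tensor_act g T = (\<chi> i j k. \<Sum>p\<in>UNIV. \<Sum>q\<in>UNIV. \<Sum>r\<in>UNIV.
     g $ i $ p * g $ j $ q * g $ k $ r * T $ p $ q $ r)"

definition Piez :: "ten3 set" where
  "Piez = {P. \<forall>i j k. P $ i $ j $ k = P $ i $ k $ j}"

definition H3 :: "ten3 set" where
  "H3 = {H. (\<forall>i j k. H $ i $ j $ k = H $ j $ i $ k \<and> H $ i $ j $ k = H $ i $ k $ j) \<and>
            (\<forall>k. (\<Sum>i\<in>UNIV. H $ i $ i $ k) = 0)}"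

definition harmonic_decomposition :: "(ten3 \<Rightarrow> vec2 \<times> vec2 \<times> ten3) \<Rightarrow> bool" where
  "harmonic_decomposition \<phi> \<longleftrightarrow>
     bij_betw \<phi> Piez (UNIV \<times> UNIV \<times> H3) \<and>
     (\<forall>P\<in>Piez. \<forall>Q\<in>Piez. \<phi> (P + Q) = \<phi> P + \<phi> Q) \<and>
     (\<forall>c. \<forall>P\<in>Piez. \<phi> (c *\<^sub>R P) = c *\<^sub>R \<phi> P) \<and>
     (\<forall>g\<in>O2. \<forall>P\<in>Piez.
        \<phi> (tensor_act g P) = (case \<phi> P of (v, w, H) \<Rightarrow> (g *v v, g *v w, tensor_act g H)))"

section \<open>Tensor operations\<close>

definition eps :: ten2 where
  "eps = (\<chi> i j. if i = 1 \<and> j = 2 then 1 else if i = 2 \<and> j = 1 then -1 else 0)"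

definition sym3 :: "ten3 \<Rightarrow> ten3" where
  "sym3 T = (\<chi> i j k. (T $ i $ j $ k + T $ i $ k $ j + T $ j $ i $ k +
                       T $ j $ k $ i + T $ k $ i $ j + T $ k $ j $ i) / 6)"

text \<open>The generalized cross product \<open>S\<^sub>1 \<times> S\<^sub>2 = - (S\<^sub>1 \<cdot> \<epsilon> \<cdot> S\<^sub>2)\<^sup>s\<close> for tensors of orders
  (1,1), (2,1) and (2,3). In the first two cases the result has order 0 or 1, and the
  symmetrization is void.\<close>

definition cross11 :: "vec2 \<Rightarrow> vec2 \<Rightarrow> real" where
  "cross11 v w = - (\<Sum>p\<in>UNIV. \<Sum>q\<in>UNIV. v $ p * eps $ p $ q * w $ q)"

definition cross21 :: "ten2 \<Rightarrow> vec2 \<Rightarrow> vec2" where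
  "cross21 S v = - (\<chi> i. \<Sum>p\<in>UNIV. \<Sum>q\<in>UNIV. S $ i $ p * eps $ p $ q * v $ q)"

definition cross23 :: "ten2 \<Rightarrow> ten3 \<Rightarrow> ten3" where
  "cross23 S H =
     - sym3 (\<chi> i j k. \<Sum>p\<in>UNIV. \<Sum>q\<in>UNIV. S $ i $ p * eps $ p $ q * H $ q $ j $ k)"

definition vHw :: "vec2 \<Rightarrow> ten3 \<Rightarrow> vec2 \<Rightarrow> vec2" where
  "vHw v H w = (\<chi> j. \<Sum>i\<in>UNIV. \<Sum>k\<in>UNIV. v $ i * H $ i $ j $ k * w $ k)"

definition Hv :: "ten3 \<Rightarrow> vec2 \<Rightarrow> ten2" where
  "Hv H v = (\<chi> i j. \<Sum>k\<in>UNIV. H $ i $ j $ k * v $ k)"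

definition triple_dot :: "ten3 \<Rightarrow> ten3 \<Rightarrow> real" where
  "triple_dot S T = (\<Sum>i\<in>UNIV. \<Sum>j\<in>UNIV. \<Sum>k\<in>UNIV. S $ i $ j $ k * T $ i $ j $ k)"

text \<open>The form \<open>c(x, \<dots>, x)\<close> attached to a tensor \<open>c\<close> of order 0, 1, 2, 3.\<close>

definition form0 :: "real \<Rightarrow> vec2 \<Rightarrow> real" where
  "form0 c x = c"

definition form1 :: "vec2 \<Rightarrow> vec2 \<Rightarrow> real" where
  "form1 c x = (\<Sum>i\<in>UNIV. c $ i * x $ i)"

definition form2 :: "ten2 \<Rightarrow> vec2 \<Rightarrow> real" where
  "form2 c x = (\<Sum>i\<in>UNIV. \<Sum>j\<in>UNIV. c $ i $ j * x $ i * x $ j)"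

definition form3 :: "ten3 \<Rightarrow> vec2 \<Rightarrow> real" where
  "form3 c x = (\<Sum>i\<in>UNIV. \<Sum>j\<in>UNIV. \<Sum>k\<in>UNIV. c $ i $ j $ k * x $ i * x $ j * x $ k)"

section \<open>The lists of covariants\<close>

text \<open>The function on \<open>Piez \<oplus> \<real>\<^sup>2\<close> attached to a tensor-valued covariant \<open>c v w H\<close>, where
  \<open>(v, w, H) = \<phi> P\<close>.\<close>

definition piez_cov ::
  "(ten3 \<Rightarrow> vec2 \<times> vec2 \<times> ten3) \<Rightarrow> ('t \<Rightarrow> vec2 \<Rightarrow> real) \<Rightarrow> (vec2 \<Rightarrow> vec2 \<Rightarrow> ten3 \<Rightarrow> 't) \<Rightarrow>
   (ten3 \<times> vec2 \<Rightarrow> real)" where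
  "piez_cov \<phi> form c =
     restrict (\<lambda>(P, x). case \<phi> P of (v, w, H) \<Rightarrow> form (c v w H) x) (Piez \<times> UNIV)"

abbreviation Id2 :: ten2 where "Id2 \<equiv> mat 1"

definition SO2_order0 :: "(vec2 \<Rightarrow> vec2 \<Rightarrow> ten3 \<Rightarrow> real) set" where
  "SO2_order0 = {
     \<lambda>v w H. v \<bullet> v,
     \<lambda>v w H. w \<bullet> w,
     \<lambda>v w H. v \<bullet> w,
     \<lambda>v w H. cross11 v w,
     \<lambda>v w H. triple_dot H H,
     \<lambda>v w H. vHw v H v \<bullet> v,
     \<lambda>v w H. vHw v H v \<bullet> w,
     \<lambda>v w H. vHw w H w \<bullet> w,
     \<lambda>v w H. vHw w H w \<bullet> v,
     \<lambda>v w H. vHw v H v \<bullet> cross21 Id2 v,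
     \<lambda>v w H. vHw v H v \<bullet> cross21 Id2 w,
     \<lambda>v w H. vHw w H w \<bullet> cross21 Id2 v,
     \<lambda>v w H. vHw w H w \<bullet> cross21 Id2 w}"

definition SO2_order1 :: "(vec2 \<Rightarrow> vec2 \<Rightarrow> ten3 \<Rightarrow> vec2) set" where
  "SO2_order1 = {
     \<lambda>v w H. v,
     \<lambda>v w H. w,
     \<lambda>v w H. cross21 Id2 v,
     \<lambda>v w H. cross21 Id2 w,
     \<lambda>v w H. vHw v H v,
     \<lambda>v w H. vHw w H w,
     \<lambda>v w H. vHw v H w,
     \<lambda>v w H. vHw v H (cross21 Id2 v),
     \<lambda>v w H. vHw w H (cross21 Id2 w),
     \<lambda>v w H. vHw v H (cross21 Id2 w)}"

definition SO2_order2 :: "(vec2 \<Rightarrow> vec2 \<Rightarrow> ten3 \<Rightarrow> ten2) set" where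
  "SO2_order2 = {
     \<lambda>v w H. Id2,
     \<lambda>v w H. Hv H v,
     \<lambda>v w H. Hv H w,
     \<lambda>v w H. Hv H (cross21 Id2 v),
     \<lambda>v w H. Hv H (cross21 Id2 w)}"

definition SO2_order3 :: "(vec2 \<Rightarrow> vec2 \<Rightarrow> ten3 \<Rightarrow> ten3) set" where
  "SO2_order3 = {
     \<lambda>v w H. H,
     \<lambda>v w H. cross23 Id2 H}"

definition O2_order0 :: "(vec2 \<Rightarrow> vec2 \<Rightarrow> ten3 \<Rightarrow> real) set" where
  "O2_order0 = {
     \<lambda>v w H. v \<bullet> v,
     \<lambda>v w H. w \<bullet> w,
     \<lambda>v w H. v \<bullet> w,
     \<lambda>v w H. triple_dot H H,
     \<lambda>v w H. vHw v H v \<bullet> v,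
     \<lambda>v w H. vHw v H v \<bullet> w,
     \<lambda>v w H. vHw w H w \<bullet> w,
     \<lambda>v w H. vHw w H w \<bullet> v}"

definition O2_order1 :: "(vec2 \<Rightarrow> vec2 \<Rightarrow> ten3 \<Rightarrow> vec2) set" where
  "O2_order1 = {
     \<lambda>v w H. v,
     \<lambda>v w H. w,
     \<lambda>v w H. vHw v H v,
     \<lambda>v w H. vHw w H w,
     \<lambda>v w H. vHw v H w}"

definition O2_order2 :: "(vec2 \<Rightarrow> vec2 \<Rightarrow> ten3 \<Rightarrow> ten2) set" where
  "O2_order2 = {
     \<lambda>v w H. Id2,
     \<lambda>v w H. Hv H v,
     \<lambda>v w H. Hv H w}"

definition O2_order3 :: "(vec2 \<Rightarrow> vec2 \<Rightarrow> ten3 \<Rightarrow> ten3) set" where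
  "O2_order3 = {\<lambda>v w H. H}"

definition SO2_covs :: "(ten3 \<Rightarrow> vec2 \<times> vec2 \<times> ten3) \<Rightarrow> nat \<Rightarrow> (ten3 \<times> vec2 \<Rightarrow> real) set" where
  "SO2_covs \<phi> n =
     (if n = 0 then piez_cov \<phi> form0 ` SO2_order0
      else if n = 1 then piez_cov \<phi> form1 ` SO2_order1
      else if n = 2 then piez_cov \<phi> form2 ` SO2_order2
      else if n = 3 then piez_cov \<phi> form3 ` SO2_order3
      else {})"

definition O2_covs :: "(ten3 \<Rightarrow> vec2 \<times> vec2 \<times> ten3) \<Rightarrow> nat \<Rightarrow> (ten3 \<times> vec2 \<Rightarrow> real) set" where
  "O2_covs \<phi> n =
     (if n = 0 then piez_cov \<phi> form0 ` O2_order0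
      else if n = 1 then piez_cov \<phi> form1 ` O2_order1
      else if n = 2 then piez_cov \<phi> form2 ` O2_order2
      else if n = 3 then piez_cov \<phi> form3 ` O2_order3
      else {})"

definition SO2_basis :: "(ten3 \<Rightarrow> vec2 \<times> vec2 \<times> ten3) \<Rightarrow> (ten3 \<times> vec2 \<Rightarrow> real) set" where
  "SO2_basis \<phi> = (\<Union>n. SO2_covs \<phi> n)"

definition O2_basis :: "(ten3 \<Rightarrow> vec2 \<times> vec2 \<times> ten3) \<Rightarrow> (ten3 \<times> vec2 \<Rightarrow> real) set" where
  "O2_basis \<phi> = (\<Union>n. O2_covs \<phi> n)"

end

theory Submission
  imports Defs
begin

text \<open>Identify the plane with the complex numbers and a harmonic tensor of order three with the
  complex number \<open>h\<close> for which its cubic form is \<open>z \<mapsto> Re (cnj h * z\<^sup>3)\<close>. By equivariance, every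
  harmonic decomposition turns a covariant into a real polynomial in \<open>v, w, x, h\<close> that is
  invariant under \<open>(v, w, x, h) \<mapsto> (u * v, u * w, u * x, u\<^sup>3 * h)\<close> for \<open>cmod u = 1\<close>, and for
  \<open>O2\<close> moreover under conjugation of all coordinates.

  Generation for \<open>SO2\<close>. A real polynomial is a combination of monomials in the coordinates and
  their conjugates. Averaging over the rotations by roots of unity of large order keeps only the
  monomials of weight zero (\<open>SO2_inv_combination\<close>), and a monomial of weight zero factors into the
  elementary ones \<open>a * cnj b\<close>, \<open>h * cnj h\<close>, \<open>cnj h * a * b * c\<close> with \<open>a, b, c\<close> among
  \<open>v, w, x\<close>, and conjugates of these (\<open>weight_zero_word_induct\<close>). Their real and imaginary parts,
  as far as they do not vanish, are the \<open>30\<close> covariants up to nonzero factors.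

  Generation for \<open>O2\<close>. Conjugation fixes the real parts of monomials and negates the imaginary
  parts, so an invariant is a combination of real parts of monomials of weight zero. Expanding the
  real part of a product of elementary monomials, the imaginary parts occur in pairs, and a
  product of two imaginary parts is a polynomial in the \<open>17\<close> real parts (\<open>Im_ev_Im_ev_mem\<close>).

  Minimality. Along the curve \<open>t \<mapsto> (t\<^bsup>40\<^esup> * v, t\<^bsup>41\<^esup> * w, t\<^bsup>44\<^esup> * x, t\<^bsup>60\<^esup> * h)\<close> each generator is a
  constant times a power of \<open>t\<close>, and its exponent is not a sum of exponents of several generators.
  Only the real and the imaginary part of the same monomial share an exponent, and the starting
  point can be chosen to make either of them vanish and not the other. Hence no generator is a
  polynomial in the others (\<open>cov_not_generated_by_others\<close>).\<close>

section \<open>Generated algebras\<close>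

lemma generated_algebra_mono:
  assumes "B \<subseteq> C"
  shows "generated_algebra V B \<subseteq> generated_algebra V C"
proof
  fix f assume "f \<in> generated_algebra V B"
  then show "f \<in> generated_algebra V C"
    using assms by induction (blast intro: generated_algebra.intros)+
qed

text \<open>Indexing the generators makes minimality and the absence of repetitions one and the same
  condition: if \<open>b i = b j\<close> for \<open>i \<noteq> j\<close>, then \<open>b i\<close> is generated by the others.\<close>

lemma minimal_integrity_basis_image:
  assumes "finite I"
    and "\<And>i. i \<in> I \<Longrightarrow> homogeneous_on V (b i)"
    and gen: "generated_algebra V (b ` I) = A"
    and new: "\<And>i. i \<in> I \<Longrightarrow> b i \<notin> generated_algebra V (b ` (I - {i}))"
  shows "minimal_integrity_basis V A (b ` I)" and "inj_on b I"
proof -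
  have "b ` I \<subseteq> A"
    using gen by (auto intro: generated_algebra.gen)
  moreover have "generated_algebra V B' \<noteq> A" if B': "B' \<subset> b ` I" for B'
  proof -
    obtain i where i: "i \<in> I" "b i \<notin> B'"
      using B' by blast
    then have "B' \<subseteq> b ` (I - {i})"
      using B' by blast
    then have "b i \<notin> generated_algebra V B'"
      using new[OF i(1)] generated_algebra_mono by blast
    then show ?thesis
      using i(1) \<open>b ` I \<subseteq> A\<close> by blast
  qed
  ultimately show "minimal_integrity_basis V A (b ` I)"
    unfolding minimal_integrity_basis_def integrity_basis_def using assms by auto
  show "inj_on b I"
  proof (rule inj_onI, rule ccontr)
    fix i j assume ij: "i \<in> I" "j \<in> I" "b i = b j" "i \<noteq> j"
    then have "b i \<in> b ` (I - {i})"
      by (metis DiffI imageI singletonD)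
    then show False
      using new[OF ij(1)] generated_algebra.gen[of "b i"] by simp
  qed
qed

definition lift :: "('x \<Rightarrow> 'y) \<Rightarrow> 'x set \<Rightarrow> ('y \<Rightarrow> real) \<Rightarrow> 'x \<Rightarrow> real" where
  "lift C X F = restrict (F \<circ> C) X"

lemma inj_lift:
  assumes "C ` X = UNIV"
  shows "inj (lift C X)"
proof (rule injI, rule ext)
  fix F G y assume eq: "lift C X F = lift C X G"
  obtain x where "x \<in> X" "y = C x"
    using assms by (metis UNIV_I image_iff)
  then show "F y = G y"
    using fun_cong[OF eq, of x] by (simp add: lift_def)
qed

lemma generated_algebra_lift:
  "generated_algebra X (lift C X ` B) = lift C X ` generated_algebra UNIV B"
proof (intro set_eqI iffI)
  fix f assume "f \<in> generated_algebra X (lift C X ` B)"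
  then show "f \<in> lift C X ` generated_algebra UNIV B"
  proof induction
    case (const c)
    have "(\<lambda>a\<in>X. c) = lift C X (\<lambda>a\<in>UNIV. c)"
      by (auto simp: lift_def)
    then show ?case
      using generated_algebra.const by blast
  next
    case (gen f)
    then show ?case
      using generated_algebra.gen by blast
  next
    case (add f g)
    then obtain F G where FG: "F \<in> generated_algebra UNIV B" "G \<in> generated_algebra UNIV B"
      "f = lift C X F" "g = lift C X G"
      by blast
    then have "(\<lambda>a\<in>X. f a + g a) = lift C X (\<lambda>a\<in>UNIV. F a + G a)"
      by (auto simp: lift_def)
    then show ?case
      using generated_algebra.add FG by blast
  next
    case (mult f g)
    then obtain F G where FG: "F \<in> generated_algebra UNIV B" "G \<in> generated_algebra UNIV B"
      "f = lift C X F" "g = lift C X G"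
      by blast
    then have "(\<lambda>a\<in>X. f a * g a) = lift C X (\<lambda>a\<in>UNIV. F a * G a)"
      by (auto simp: lift_def)
    then show ?case
      using generated_algebra.mult FG by blast
  qed
next
  fix f assume "f \<in> lift C X ` generated_algebra UNIV B"
  then obtain F where "F \<in> generated_algebra UNIV B" and f: "f = lift C X F"
    by blast
  from this(1) have "lift C X F \<in> generated_algebra X (lift C X ` B)"
  proof induction
    case (const c)
    have "lift C X (\<lambda>a\<in>UNIV. c) = (\<lambda>a\<in>X. c)"
      by (auto simp: lift_def)
    then show ?case
      using generated_algebra.const by metis
  next
    case (gen f)
    then show ?case
      using generated_algebra.gen by blast
  next
    case (add F G)
    have "lift C X (\<lambda>a\<in>UNIV. F a + G a) = (\<lambda>a\<in>X. lift C X F a + lift C X G a)"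
      by (auto simp: lift_def)
    then show ?case
      using generated_algebra.add add by metis
  next
    case (mult F G)
    have "lift C X (\<lambda>a\<in>UNIV. F a * G a) = (\<lambda>a\<in>X. lift C X F a * lift C X G a)"
      by (auto simp: lift_def)
    then show ?case
      using generated_algebra.mult mult by metis
  qed
  then show "f \<in> generated_algebra X (lift C X ` B)"
    using f by simp
qed

lemma alg_const: "(\<lambda>p. c) \<in> generated_algebra UNIV B"
  using generated_algebra.const[of c UNIV B] by (simp add: restrict_def)

lemma alg_add:
  "F \<in> generated_algebra UNIV B \<Longrightarrow> G \<in> generated_algebra UNIV B \<Longrightarrow>
    (\<lambda>p. F p + G p) \<in> generated_algebra UNIV B"
  using generated_algebra.add[of F UNIV B G] by (simp add: restrict_def)

lemma alg_mult:
  "F \<in> generated_algebra UNIV B \<Longrightarrow> G \<in> generated_algebra UNIV B \<Longrightarrow>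
    (\<lambda>p. F p * G p) \<in> generated_algebra UNIV B"
  using generated_algebra.mult[of F UNIV B G] by (simp add: restrict_def)

lemma alg_scale:
  "F \<in> generated_algebra UNIV B \<Longrightarrow> (\<lambda>p. c * F p) \<in> generated_algebra UNIV B"
  by (rule alg_mult[OF alg_const])

lemma alg_diff:
  "F \<in> generated_algebra UNIV B \<Longrightarrow> G \<in> generated_algebra UNIV B \<Longrightarrow>
    (\<lambda>p. F p - G p) \<in> generated_algebra UNIV B"
  using alg_add[OF _ alg_scale[of G B "-1"], of F] by simp

section \<open>The complex model\<close>

text \<open>A point \<open>(v, w, x, h)\<close> stands for three vectors, read as complex numbers, and for the
  harmonic tensor whose cubic form is \<open>z \<mapsto> Re (cnj h * z\<^sup>3)\<close>.\<close>

type_synonym model = "complex \<times> complex \<times> complex \<times> complex"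

datatype slot = SV | SW | SX

fun co :: "slot \<Rightarrow> model \<Rightarrow> complex" where
  "co SV (v, w, x, h) = v"
| "co SW (v, w, x, h) = w"
| "co SX (v, w, x, h) = x"

fun hc :: "model \<Rightarrow> complex" where
  "hc (v, w, x, h) = h"

fun rot :: "complex \<Rightarrow> model \<Rightarrow> model" where
  "rot u (v, w, x, h) = (u * v, u * w, u * x, u ^ 3 * h)"

fun reflect :: "model \<Rightarrow> model" where
  "reflect (v, w, x, h) = (cnj v, cnj w, cnj x, cnj h)"

lemma co_rot [simp]: "co i (rot u z) = u * co i z"
  by (cases z; cases i) auto

lemma hc_rot [simp]: "hc (rot u z) = u ^ 3 * hc z"
  by (cases z) auto

lemma co_reflect [simp]: "co i (reflect z) = cnj (co i z)"
  by (cases z; cases i) auto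

lemma hc_reflect [simp]: "hc (reflect z) = cnj (hc z)"
  by (cases z) auto

definition SO2_invs :: "(model \<Rightarrow> real) set" where
  "SO2_invs = {F. real_polynomial_function F \<and> (\<forall>u z. cmod u = 1 \<longrightarrow> F (rot u z) = F z)}"

definition O2_invs :: "(model \<Rightarrow> real) set" where
  "O2_invs = {F \<in> SO2_invs. \<forall>z. F (reflect z) = F z}"

text \<open>The elementary rotation-invariant monomials. Up to conjugation no others are needed: three
  letters of weight one balance \<open>cnj h\<close>, which has weight \<open>-3\<close>.\<close>

datatype mono = Quad slot slot | HH | Cub slot slot slot

fun ev :: "mono \<Rightarrow> model \<Rightarrow> complex" where
  "ev (Quad i j) z = co i z * cnj (co j z)"
| "ev HH z = hc z * cnj (hc z)"
| "ev (Cub i j k) z = cnj (hc z) * co i z * co j z * co k z"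

lemma ev_rot:
  assumes "cmod u = 1"
  shows "ev m (rot u z) = ev m z"
proof -
  have unit: "u * cnj u = 1"
    using assms by (simp add: complex_norm_square[symmetric])
  show ?thesis
  proof (cases m)
    case (Quad i j)
    have "ev m (rot u z) = (u * cnj u) * ev m z"
      unfolding Quad by simp
    then show ?thesis using unit by simp
  next
    case HH
    have "ev m (rot u z) = (u * cnj u) ^ 3 * ev m z"
      unfolding HH by (simp add: power_mult_distrib)
    then show ?thesis using unit by simp
  next
    case (Cub i j k)
    have "ev m (rot u z) = (u * cnj u) ^ 3 * ev m z"
      unfolding Cub by (simp add: power_mult_distrib power3_eq_cube)
    then show ?thesis using unit by simp
  qed
qed

lemma ev_reflect: "ev m (reflect z) = cnj (ev m z)"
  by (cases m) auto

datatype idx = RePart mono | ImPart mono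

text \<open>The coefficients are those of the tensor formulas. The full contraction of the harmonic tensor
  with itself is \<open>4 * cmod h ^ 2\<close>. Replacing a vector \<open>v\<close> by \<open>Id2 \<times> v\<close> multiplies it by \<open>\<i>\<close> and so
  turns \<open>Re\<close> into \<open>- Im\<close>; the cross products \<open>v \<times> w\<close> and \<open>Id2 \<times> H\<close> come out as \<open>+ Im\<close>.\<close>

fun cov :: "idx \<Rightarrow> model \<Rightarrow> real" where
  "cov (RePart m) z = (if m = HH then 4 else 1) * Re (ev m z)"
| "cov (ImPart m) z = (if m = Quad SV SW \<or> m = Cub SX SX SX then 1 else -1) * Im (ev m z)"

definition O2_idx :: "idx set" where
  "O2_idx = {
     RePart (Quad SV SV), RePart (Quad SW SW), RePart (Quad SV SW), RePart HH,
     RePart (Cub SV SV SV), RePart (Cub SV SV SW), RePart (Cub SW SW SW), RePart (Cub SV SW SW),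
     RePart (Quad SV SX), RePart (Quad SW SX),
     RePart (Cub SV SV SX), RePart (Cub SW SW SX), RePart (Cub SV SW SX),
     RePart (Quad SX SX), RePart (Cub SV SX SX), RePart (Cub SW SX SX),
     RePart (Cub SX SX SX)}"

definition SO2_idx :: "idx set" where
  "SO2_idx = O2_idx \<union> {
     ImPart (Quad SV SW),
     ImPart (Cub SV SV SV), ImPart (Cub SV SV SW), ImPart (Cub SV SW SW), ImPart (Cub SW SW SW),
     ImPart (Quad SV SX), ImPart (Quad SW SX),
     ImPart (Cub SV SV SX), ImPart (Cub SW SW SX), ImPart (Cub SV SW SX),
     ImPart (Cub SV SX SX), ImPart (Cub SW SX SX),
     ImPart (Cub SX SX SX)}"

lemma finite_SO2_idx: "finite SO2_idx"
  by (simp add: SO2_idx_def O2_idx_def)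

lemma card_SO2_idx: "card SO2_idx = 30"
  by (simp add: SO2_idx_def O2_idx_def)

lemma card_O2_idx: "card O2_idx = 17"
  by (simp add: O2_idx_def)

lemma bounded_linear_co: "bounded_linear (co i)"
proof -
  have "co SV = (\<lambda>z. fst z)" "co SW = (\<lambda>z. fst (snd z))" "co SX = (\<lambda>z. fst (snd (snd z)))"
    by auto
  then show ?thesis
    by (cases i) (auto intro!: bounded_linear_intros)
qed

lemma bounded_linear_hc: "bounded_linear hc"
proof -
  have "hc = (\<lambda>z. snd (snd (snd z)))"
    by auto
  moreover have "bounded_linear (\<lambda>z::model. snd (snd (snd z)))"
    by (intro bounded_linear_intros)
  ultimately show ?thesis
    by simp
qed

lemma real_polynomial_Re_Im_mult:
  assumes "real_polynomial_function (\<lambda>z. Re (F z)) \<and> real_polynomial_function (\<lambda>z. Im (F z))"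
    and "real_polynomial_function (\<lambda>z. Re (G z)) \<and> real_polynomial_function (\<lambda>z. Im (G z))"
  shows "real_polynomial_function (\<lambda>z. Re (F z * G z)) \<and>
    real_polynomial_function (\<lambda>z. Im (F z * G z))"
  using assms
  by (simp add: real_polynomial_function_diff real_polynomial_function.intros(3,4))

lemma real_polynomial_Re_Im_ev:
  "real_polynomial_function (\<lambda>z. Re (ev m z)) \<and> real_polynomial_function (\<lambda>z. Im (ev m z))"
proof -
  have lin: "real_polynomial_function (\<lambda>z. Re (F z)) \<and> real_polynomial_function (\<lambda>z. Im (F z))"
    if "bounded_linear F" for F :: "model \<Rightarrow> complex"
    using that by (intro conjI real_polynomial_function.intros(1)
        bounded_linear_compose[OF bounded_linear_Re] bounded_linear_compose[OF bounded_linear_Im])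
  note l = lin[OF bounded_linear_co] lin[OF bounded_linear_hc]
    lin[OF bounded_linear_compose[OF bounded_linear_cnj bounded_linear_co]]
    lin[OF bounded_linear_compose[OF bounded_linear_cnj bounded_linear_hc]]
  show ?thesis
    by (cases m) (simp_all only: ev.simps, (rule real_polynomial_Re_Im_mult l)+)
qed

lemma real_polynomial_cov: "real_polynomial_function (cov i)"
proof (cases i)
  case (RePart m)
  then have "cov i = (\<lambda>z. (if m = HH then 4 else 1) * Re (ev m z))"
    by auto
  then show ?thesis
    using real_polynomial_Re_Im_ev by (simp only: real_polynomial_function.intros)
next
  case (ImPart m)
  then have "cov i = (\<lambda>z. (if m = Quad SV SW \<or> m = Cub SX SX SX then 1 else -1) * Im (ev m z))"
    by auto
  then show ?thesis
    using real_polynomial_Re_Im_ev by (simp only: real_polynomial_function.intros)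
qed

lemma cov_SO2_inv: "cov i \<in> SO2_invs"
proof -
  have "cov i (rot u z) = cov i z" if "cmod u = 1" for u z
    using that by (cases i) (simp_all add: ev_rot del: ev.simps rot.simps)
  then show ?thesis
    unfolding SO2_invs_def by (simp add: real_polynomial_cov del: split_paired_All)
qed

lemma cov_O2_inv: "i \<in> O2_idx \<Longrightarrow> cov i \<in> O2_invs"
proof -
  assume "i \<in> O2_idx"
  then have "cov i (reflect z) = cov i z" for z
    by (cases i) (auto simp: O2_idx_def ev_reflect simp del: ev.simps reflect.simps)
  then show ?thesis
    unfolding O2_invs_def by (simp add: cov_SO2_inv del: split_paired_All)
qed

lemma generated_subset_SO2_invs:
  assumes "B \<subseteq> SO2_invs"
  shows "generated_algebra UNIV B \<subseteq> SO2_invs"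
proof
  fix F assume "F \<in> generated_algebra UNIV B"
  then show "F \<in> SO2_invs"
  proof induction
    case (gen F)
    then show ?case using assms by blast
  qed (simp_all add: SO2_invs_def restrict_def real_polynomial_function.intros(2-4)
      del: split_paired_All)
qed

lemma generated_subset_O2_invs:
  assumes "B \<subseteq> O2_invs"
  shows "generated_algebra UNIV B \<subseteq> O2_invs"
proof
  fix F assume F: "F \<in> generated_algebra UNIV B"
  have "B \<subseteq> SO2_invs"
    using assms by (auto simp: O2_invs_def)
  then have "F \<in> SO2_invs"
    using F generated_subset_SO2_invs by blast
  moreover have "F (reflect z) = F z" for z
    using F by induction
      (use assms in \<open>auto simp: O2_invs_def simp del: reflect.simps split_paired_All\<close>)
  ultimately show "F \<in> O2_invs"
    by (simp add: O2_invs_def del: split_paired_All)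
qed

section \<open>Minimality\<close>

text \<open>Along the curve below, every listed covariant becomes a constant times a power of \<open>t\<close>. The
  powers \<open>40\<close>, \<open>41\<close>, \<open>44\<close> are chosen so that different sums of two of them, and different sums of
  three of them, are different. With \<open>60\<close> for \<open>h\<close> the exponents of the generators lie in
  \<open>{80..88}\<close>, \<open>{120}\<close> and \<open>{180..192}\<close>, whereas a product of two or more generators has an exponent
  in \<open>{160..176}\<close> or at least \<open>200\<close>. So no generator has the exponent of a product.\<close>

fun slot_wt :: "slot \<Rightarrow> nat" where
  "slot_wt SV = 40" | "slot_wt SW = 41" | "slot_wt SX = 44"

fun wt :: "mono \<Rightarrow> nat" where
  "wt (Quad i j) = slot_wt i + slot_wt j"
| "wt HH = 120"
| "wt (Cub i j k) = 60 + slot_wt i + slot_wt j + slot_wt k"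

fun curve :: "model \<Rightarrow> real \<Rightarrow> model" where
  "curve (v, w, x, h) t =
    (of_real (t ^ 40) * v, of_real (t ^ 41) * w, of_real (t ^ 44) * x, of_real (t ^ 60) * h)"

lemma ev_curve: "ev m (curve e t) = of_real (t ^ wt m) * ev m e"
proof -
  have co: "co i (curve e t) = of_real (t ^ slot_wt i) * co i e" for i
    by (cases e; cases i) auto
  have hc: "hc (curve e t) = of_real (t ^ 60) * hc e"
    by (cases e) auto
  show ?thesis
    by (cases m) (auto simp: co hc power_add power_mult_distrib)
qed

fun mono_of :: "idx \<Rightarrow> mono" where
  "mono_of (RePart m) = m" | "mono_of (ImPart m) = m"

lemma cov_curve: "cov i (curve e t) = cov i e * t ^ wt (mono_of i)"
  by (cases i) (auto simp: ev_curve simp del: ev.simps)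

text \<open>Two different listed covariants have the same exponent only if they are the real and the
  imaginary part of one monomial; the starting point of the curve is chosen to make the other part
  vanish.\<close>

lemma real_or_imaginary_point:
  assumes "i \<in> SO2_idx"
  obtains e where "cov i e \<noteq> 0"
    and "\<And>j. mono_of j = mono_of i \<Longrightarrow> j \<noteq> i \<Longrightarrow> cov j e = 0"
proof (cases i)
  case (RePart m)
  have "ev m (1, 1, 1, 1) = 1"
  proof -
    have "co k (1, 1, 1, 1) = 1" for k by (cases k) auto
    then show ?thesis by (cases m) auto
  qed
  then have "cov (RePart m) (1, 1, 1, 1) \<noteq> 0" "cov (ImPart m) (1, 1, 1, 1) = 0"
    by simp_all
  moreover have "j = ImPart m" if "mono_of j = m" "j \<noteq> i" for j
    using that RePart by (cases j) auto
  ultimately show thesis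
    using that[of "(1, 1, 1, 1)"] RePart by (metis mono_of.simps(1))
next
  case (ImPart m)
  have j: "j = RePart m" if "mono_of j = m" "j \<noteq> i" for j
    using that ImPart by (cases j) auto
  have "\<exists>e. Im (ev m e) \<noteq> 0 \<and> Re (ev m e) = 0"
  proof (cases m)
    case (Cub a b c)
    have "co k (1, 1, 1, \<i>) = 1" for k by (cases k) auto
    then show ?thesis using Cub by (intro exI[of _ "(1, 1, 1, \<i>)"]) auto
  next
    case (Quad a b)
    then have "m = Quad SV SW \<or> m = Quad SV SX \<or> m = Quad SW SX"
      using assms ImPart by (auto simp: SO2_idx_def O2_idx_def)
    then show ?thesis
    proof (elim disjE)
      assume "m = Quad SV SW"
      then show ?thesis by (intro exI[of _ "(1, \<i>, 1, 1)"]) auto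
    next
      assume "m = Quad SV SX"
      then show ?thesis by (intro exI[of _ "(1, 1, \<i>, 1)"]) auto
    next
      assume "m = Quad SW SX"
      then show ?thesis by (intro exI[of _ "(1, 1, \<i>, 1)"]) auto
    qed
  next
    case HH
    then show ?thesis using assms ImPart by (auto simp: SO2_idx_def O2_idx_def)
  qed
  then obtain e where "Im (ev m e) \<noteq> 0" "Re (ev m e) = 0" by blast
  then have "cov (ImPart m) e \<noteq> 0" "cov (RePart m) e = 0"
    by simp_all
  then show thesis
    using that[of e] ImPart j by (metis mono_of.simps(2))
qed

lemma inj_on_wt: "inj_on wt (mono_of ` SO2_idx)"
proof -
  have "mono_of ` SO2_idx = mono_of ` O2_idx"
    by (auto simp: SO2_idx_def O2_idx_def)
  moreover have "card (wt ` mono_of ` O2_idx) = card (mono_of ` O2_idx)"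
    by (simp add: O2_idx_def)
  ultimately show ?thesis
    by (simp add: eq_card_imp_inj_on O2_idx_def)
qed

lemma wt_range: "i \<in> SO2_idx \<Longrightarrow> wt (mono_of i) \<in> {80..88} \<union> {120} \<union> {180..192}"
  by (auto simp: SO2_idx_def O2_idx_def)

text \<open>Exponents occurring in polynomials in the other generators stay in the set \<open>S\<close>, which is closed
  under addition and misses the exponent \<open>n\<close> of the covariant in question.\<close>

lemma cov_not_generated_by_others:
  assumes i: "i \<in> SO2_idx"
  shows "cov i \<notin> generated_algebra UNIV (cov ` (SO2_idx - {i}))"
proof
  assume gen: "cov i \<in> generated_algebra UNIV (cov ` (SO2_idx - {i}))"
  define n where "n = wt (mono_of i)"
  define S where "S = ({0} \<union> {80..88} \<union> {120} \<union> {160..}) - {n}"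
  have n: "n \<in> {80..88} \<union> {120} \<union> {180..192}"
    unfolding n_def by (rule wt_range[OF i])
  have S_add: "k + l \<in> S" if "k \<in> S" "l \<in> S" for k l
    using that n unfolding S_def by auto
  obtain e where e: "cov i e \<noteq> 0"
    and partner: "\<And>j. mono_of j = mono_of i \<Longrightarrow> j \<noteq> i \<Longrightarrow> cov j e = 0"
    using real_or_imaginary_point[OF i] by blast
  have "\<exists>P. (\<forall>t. F (curve e t) = poly P t) \<and> (\<forall>k. coeff P k \<noteq> 0 \<longrightarrow> k \<in> S)"
    if "F \<in> generated_algebra UNIV (cov ` (SO2_idx - {i}))" for F
    using that
  proof induction
    case (const c)
    have "0 \<in> S" using n by (auto simp: S_def)
    then show ?case
      by (intro exI[of _ "[:c:]"]) (auto simp: coeff_pCons split: nat.splits)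
  next
    case (gen F)
    then obtain j where j: "j \<in> SO2_idx" "j \<noteq> i" "F = cov j"
      by auto
    have "wt (mono_of j) \<in> S" if "cov j e \<noteq> 0"
    proof -
      have "mono_of j \<noteq> mono_of i"
        using that partner j by blast
      then have "wt (mono_of j) \<noteq> n"
        using inj_onD[OF inj_on_wt] i j unfolding n_def by blast
      then show ?thesis
        using wt_range[OF j(1)] by (auto simp: S_def)
    qed
    then show ?case
      by (intro exI[of _ "monom (cov j e) (wt (mono_of j))"])
        (auto simp: j cov_curve poly_monom coeff_monom simp del: cov.simps)
  next
    case (add F G)
    then obtain P Q where "\<forall>t. F (curve e t) = poly P t" "\<forall>k. coeff P k \<noteq> 0 \<longrightarrow> k \<in> S"
      "\<forall>t. G (curve e t) = poly Q t" "\<forall>k. coeff Q k \<noteq> 0 \<longrightarrow> k \<in> S"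
      by blast
    then show ?case
      by (intro exI[of _ "P + Q"]) force
  next
    case (mult F G)
    then obtain P Q where PQ: "\<forall>t. F (curve e t) = poly P t" "\<forall>k. coeff P k \<noteq> 0 \<longrightarrow> k \<in> S"
      "\<forall>t. G (curve e t) = poly Q t" "\<forall>k. coeff Q k \<noteq> 0 \<longrightarrow> k \<in> S"
      by blast
    have "k \<in> S" if "coeff (P * Q) k \<noteq> 0" for k
    proof -
      have "(\<Sum>a\<le>k. coeff P a * coeff Q (k - a)) \<noteq> 0"
        using that by (simp add: coeff_mult)
      then obtain a where "a \<le> k" "coeff P a * coeff Q (k - a) \<noteq> 0"
        by (meson atMost_iff sum.not_neutral_contains_not_neutral)
      then show ?thesis
        using PQ S_add[of a "k - a"] by auto
    qed
    then show ?case
      using PQ by (intro exI[of _ "P * Q"]) auto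
  qed
  from this[OF gen] obtain P where P: "\<forall>t. cov i (curve e t) = poly P t"
    and supp: "\<forall>k. coeff P k \<noteq> 0 \<longrightarrow> k \<in> S"
    by blast
  have "poly P = poly (monom (cov i e) n)"
    using P by (auto simp: fun_eq_iff cov_curve poly_monom n_def simp del: cov.simps)
  then have "P = monom (cov i e) n"
    by (simp add: poly_eq_poly_eq_iff)
  then have "n \<in> S"
    using supp e by (auto simp: coeff_monom simp del: cov.simps)
  then show False
    by (simp add: S_def)
qed

section \<open>Monomials of weight zero\<close>

text \<open>Words of letters make the exchange of factors explicit: the monomial has letters from \<open>ps\<close>,
  conjugated letters from \<open>qs\<close>, and \<open>d\<close> respectively \<open>e\<close> factors \<open>h\<close> and \<open>cnj h\<close>. A rotation
  by \<open>u\<close> multiplies it by \<open>u\<close> to the power \<open>(length ps + 3 * d) - (length qs + 3 * e)\<close>.\<close>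

definition word :: "slot list \<Rightarrow> slot list \<Rightarrow> nat \<Rightarrow> nat \<Rightarrow> model \<Rightarrow> complex" where
  "word ps qs d e z = (\<Prod>i\<leftarrow>ps. co i z) * (\<Prod>i\<leftarrow>qs. cnj (co i z)) * hc z ^ d * cnj (hc z) ^ e"

definition weight_zero :: "slot list \<Rightarrow> slot list \<Rightarrow> nat \<Rightarrow> nat \<Rightarrow> bool" where
  "weight_zero ps qs d e \<longleftrightarrow> length ps + 3 * d = length qs + 3 * e"

lemma word_mult:
  "word ps qs d e z * word ps' qs' d' e' z = word (ps @ ps') (qs @ qs') (d + d') (e + e') z"
  by (simp add: word_def power_add)

lemma word_rot:
  "word ps qs d e (rot u z) =
    u ^ (length ps + 3 * d) * cnj u ^ (length qs + 3 * e) * word ps qs d e z"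
proof -
  have "(\<Prod>i\<leftarrow>ps. co i (rot u z)) = u ^ length ps * (\<Prod>i\<leftarrow>ps. co i z)"
    by (induction ps) auto
  moreover have "(\<Prod>i\<leftarrow>qs. cnj (co i (rot u z))) = cnj u ^ length qs * (\<Prod>i\<leftarrow>qs. cnj (co i z))"
    by (induction qs) auto
  ultimately show ?thesis
    by (simp add: word_def power_mult_distrib power_add power_mult)
qed

lemma word_reflect: "word ps qs d e (reflect z) = cnj (word ps qs d e z)"
proof -
  have "(\<Prod>i\<leftarrow>ps. co i (reflect z)) = cnj (\<Prod>i\<leftarrow>ps. co i z)"
    by (induction ps) auto
  moreover have "(\<Prod>i\<leftarrow>qs. cnj (co i (reflect z))) = cnj (\<Prod>i\<leftarrow>qs. cnj (co i z))"
    by (induction qs) auto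
  ultimately show ?thesis
    by (simp add: word_def)
qed

text \<open>Any word of weight zero can be shortened: a letter cancels against a conjugated letter, \<open>h\<close>
  against \<open>cnj h\<close>, and if neither is possible then all letters are of one kind and three of them
  cancel against one \<open>h\<close> or \<open>cnj h\<close>. Hence the elementary monomials and their conjugates generate
  all words of weight zero.\<close>

lemma weight_zero_word_induct:
  assumes one: "(\<lambda>z. 1) \<in> E"
    and mult: "\<And>F m. F \<in> E \<Longrightarrow> (\<lambda>z. F z * ev m z) \<in> E"
    and mult_cnj: "\<And>F m. F \<in> E \<Longrightarrow> (\<lambda>z. F z * cnj (ev m z)) \<in> E"
    and "weight_zero ps qs d e"
  shows "word ps qs d e \<in> E"
  using \<open>weight_zero ps qs d e\<close>
proof (induction "length ps + length qs + d + e" arbitrary: ps qs d e rule: less_induct)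
  case less
  have len: "length ps + 3 * d = length qs + 3 * e"
    using less.prems by (simp add: weight_zero_def)
  consider (letters) i ps' j qs' where "ps = i # ps'" "qs = j # qs'"
    | (hs) d' e' where "d = Suc d'" "e = Suc e'"
    | (cubic) i j k ps' e' where "ps = i # j # k # ps'" "e = Suc e'"
    | (cubic_cnj) i j k qs' d' where "qs = i # j # k # qs'" "d = Suc d'"
    | (empty) "ps = []" "qs = []" "d = 0" "e = 0"
  proof -
    have three: "\<exists>i j k xs'. xs = i # j # k # xs'" if "3 \<le> length xs" for xs :: "slot list"
      using that by (cases xs rule: remdups_adj.cases) (auto simp: Suc_le_length_iff numeral_3_eq_3)
    show thesis
    proof (cases ps; cases qs; cases d; cases e)
    qed (use len three[of ps] three[of qs] that in \<open>auto\<close>)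
  qed
  then show ?case
  proof cases
    case letters
    then have "word ps' qs' d e \<in> E"
      using len by (intro less.hyps) (auto simp: weight_zero_def)
    moreover have "word ps qs d e = (\<lambda>z. word ps' qs' d e z * ev (Quad i j) z)"
      by (auto simp: word_def letters)
    ultimately show ?thesis using mult by metis
  next
    case hs
    then have "word ps qs d' e' \<in> E"
      using len by (intro less.hyps) (auto simp: weight_zero_def)
    moreover have "word ps qs d e = (\<lambda>z. word ps qs d' e' z * ev HH z)"
      by (auto simp: word_def hs)
    ultimately show ?thesis using mult by metis
  next
    case cubic
    then have "word ps' qs d e' \<in> E"
      using len by (intro less.hyps) (auto simp: weight_zero_def)
    moreover have "word ps qs d e = (\<lambda>z. word ps' qs d e' z * ev (Cub i j k) z)"
      by (auto simp: word_def cubic)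
    ultimately show ?thesis using mult by metis
  next
    case cubic_cnj
    then have "word ps qs' d' e \<in> E"
      using len by (intro less.hyps) (auto simp: weight_zero_def)
    moreover have "word ps qs d e = (\<lambda>z. word ps qs' d' e z * cnj (ev (Cub i j k) z))"
      by (auto simp: word_def cubic_cnj)
    ultimately show ?thesis using mult_cnj by metis
  next
    case empty
    then have "word ps qs d e = (\<lambda>z. 1)"
      by (auto simp: word_def)
    then show ?thesis using one by simp
  qed
qed

section \<open>Invariants are combinations of words of weight zero\<close>

inductive combination :: "(slot list \<Rightarrow> slot list \<Rightarrow> nat \<Rightarrow> nat \<Rightarrow> bool) \<Rightarrow> (model \<Rightarrow> complex) \<Rightarrow> bool"
  for W where
  scaled: "W ps qs d e \<Longrightarrow> combination W (\<lambda>z. c * word ps qs d e z)"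
| plus: "combination W F \<Longrightarrow> combination W G \<Longrightarrow> combination W (\<lambda>z. F z + G z)"

lemma combination_mult:
  assumes "combination (\<lambda>_ _ _ _. True) F" "combination (\<lambda>_ _ _ _. True) G"
  shows "combination (\<lambda>_ _ _ _. True) (\<lambda>z. F z * G z)"
  using assms(1)
proof induction
  case (scaled ps qs d e c)
  show ?case
    using assms(2)
  proof induction
    case (scaled ps' qs' d' e' c')
    have "(\<lambda>z. c * word ps qs d e z * (c' * word ps' qs' d' e' z)) =
        (\<lambda>z. (c * c') * word (ps @ ps') (qs @ qs') (d + d') (e + e') z)"
      by (auto simp flip: word_mult)
    then show ?case
      by (metis combination.scaled)
  next
    case (plus G G')
    then show ?case
      by (simp add: distrib_left combination.plus)
  qed
next
  case (plus F F')
  then show ?case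
    by (simp add: distrib_right combination.plus)
qed

lemma combination_real_linear:
  fixes g :: "complex \<Rightarrow> real"
  assumes "linear g"
    and "\<And>c. combination W (\<lambda>z. c * F z)" and "\<And>c. combination W (\<lambda>z. c * cnj (F z))"
  shows "combination W (\<lambda>z. of_real (g (F z)))"
proof -
  obtain a b where g: "\<And>y. g y = a * Re y + b * Im y"
  proof
    fix y
    have "y = Re y *\<^sub>R 1 + Im y *\<^sub>R \<i>"
      by (simp add: complex_eq_iff)
    then have "g y = g (Re y *\<^sub>R 1 + Im y *\<^sub>R \<i>)"
      by simp
    also have "\<dots> = g 1 * Re y + g \<i> * Im y"
      by (simp add: linear_add[OF assms(1)] linear_scale[OF assms(1)])
    finally show "g y = g 1 * Re y + g \<i> * Im y" .
  qed
  have "of_real (g y) = Complex (a / 2) (- b / 2) * y + Complex (a / 2) (b / 2) * cnj y" for y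
    by (simp add: g complex_eq_iff)
  then have "(\<lambda>z. of_real (g (F z))) =
      (\<lambda>z. Complex (a / 2) (- b / 2) * F z + Complex (a / 2) (b / 2) * cnj (F z))"
    by auto
  then show ?thesis
    using combination.plus[OF assms(2) assms(3)] by metis
qed

text \<open>Real coordinates are combinations of a complex coordinate and its conjugate, so every real
  polynomial is a complex combination of words.\<close>

lemma real_polynomial_combination:
  assumes "real_polynomial_function F"
  shows "combination (\<lambda>_ _ _ _. True) (\<lambda>z. of_real (F z))"
  using assms
proof induction
  case (linear f)
  then have f: "linear f"
    by (rule bounded_linear.linear)
  define g where "g i y = (case i of SV \<Rightarrow> f (y, 0, 0, 0) | SW \<Rightarrow> f (0, y, 0, 0) | SX \<Rightarrow> f (0, 0, y, 0))"
    for i y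
  define g' where "g' y = f (0, 0, 0, y)" for y
  have lin: "linear (\<lambda>y. f (y, 0, 0, 0))" "linear (\<lambda>y. f (0, y, 0, 0))" "linear (\<lambda>y. f (0, 0, y, 0))"
    "linear (\<lambda>y. f (0, 0, 0, y))"
    using linear_add[OF f, symmetric] linear_scale[OF f, symmetric] by (auto intro!: linearI)
  have "combination (\<lambda>_ _ _ _. True) (\<lambda>z. of_real (g i (co i z)))" for i
  proof (rule combination_real_linear)
    show "linear (g i)" using lin by (cases i) (simp_all add: g_def[abs_def])
    show "combination (\<lambda>_ _ _ _. True) (\<lambda>z. c * co i z)" for c
      using combination.scaled[of "\<lambda>_ _ _ _. True" "[i]" "[]" 0 0 c] by (simp add: word_def)
    show "combination (\<lambda>_ _ _ _. True) (\<lambda>z. c * cnj (co i z))" for c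
      using combination.scaled[of "\<lambda>_ _ _ _. True" "[]" "[i]" 0 0 c] by (simp add: word_def)
  qed
  moreover have "combination (\<lambda>_ _ _ _. True) (\<lambda>z. of_real (g' (hc z)))"
  proof (rule combination_real_linear)
    show "linear g'" using lin by (simp add: g'_def[abs_def])
    show "combination (\<lambda>_ _ _ _. True) (\<lambda>z. c * hc z)" for c
      using combination.scaled[of "\<lambda>_ _ _ _. True" "[]" "[]" 1 0 c] by (simp add: word_def)
    show "combination (\<lambda>_ _ _ _. True) (\<lambda>z. c * cnj (hc z))" for c
      using combination.scaled[of "\<lambda>_ _ _ _. True" "[]" "[]" 0 1 c] by (simp add: word_def)
  qed
  moreover have "f z = g SV (co SV z) + g SW (co SW z) + g SX (co SX z) + g' (hc z)" for z
    by (cases z) (simp add: g_def g'_def linear_add[OF f, symmetric])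
  ultimately show ?case
    by (simp add: combination.plus)
next
  case (const c)
  show ?case
    using combination.scaled[of "\<lambda>_ _ _ _. True" "[]" "[]" 0 0 "of_real c"] by (simp add: word_def)
qed (simp_all add: combination.plus combination_mult)

text \<open>Averaging over the rotations by the \<open>n\<close>-th roots of unity kills every word whose weight is not
  divisible by \<open>n\<close>, so for large \<open>n\<close> only weight zero survives. A finite average avoids integrating
  over the circle.\<close>

definition root1 :: "nat \<Rightarrow> nat \<Rightarrow> complex" where
  "root1 n j = exp (2 * of_real pi * \<i> * of_nat j / of_nat n)"

definition average :: "nat \<Rightarrow> (model \<Rightarrow> complex) \<Rightarrow> model \<Rightarrow> complex" where
  "average n F z = (\<Sum>j<n. F (rot (root1 n j) z)) / of_nat n"

lemma cmod_root1: "cmod (root1 n j) = 1"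
  by (simp add: root1_def)

lemma root1_power: "root1 n j = root1 n 1 ^ j"
  by (simp add: root1_def flip: exp_of_nat_mult) (simp add: mult_ac)

text \<open>The bounds \<open>a < n\<close> and \<open>b < n\<close> ensure that \<open>a\<close> and \<open>b\<close> differ modulo \<open>n\<close>.\<close>

lemma sum_root1_powers:
  assumes "a < n" "b < n" "a \<noteq> b"
  shows "(\<Sum>j<n. root1 n j ^ a * cnj (root1 n j) ^ b) = 0"
proof -
  define w where "w = root1 n 1"
  define r where "r = w ^ a * cnj w ^ b"
  have w: "w * cnj w = 1"
    unfolding w_def by (simp add: complex_norm_square[symmetric] cmod_root1)
  have "w ^ n = root1 n n"
    unfolding w_def by (rule root1_power[symmetric])
  also have "\<dots> = 1"
    using assms by (simp add: root1_def)
  finally have "r ^ n = 1"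
    unfolding r_def by (simp add: power_mult_distrib power_mult[symmetric] mult.commute[of _ n])
      (simp add: power_mult flip: complex_cnj_power)
  moreover have "r \<noteq> 1"
  proof
    assume "r = 1"
    then have "w ^ a * (w * cnj w) ^ b = w ^ b"
      unfolding r_def power_mult_distrib by (simp add: mult_ac)
    then have "root1 n a = root1 n b"
      using w unfolding w_def root1_power[of n a] root1_power[of n b] by simp
    then have "a mod n = b mod n"
      using complex_root_unity_eq[of n a b] assms by (simp add: root1_def)
    then show False
      using assms by simp
  qed
  ultimately have "(\<Sum>j<n. r ^ j) = 0"
    by (simp add: geometric_sum)
  moreover have "root1 n j ^ a * cnj (root1 n j) ^ b = r ^ j" for j
    unfolding r_def w_def root1_power[of n j]
    by (simp add: power_mult_distrib power_mult[symmetric] mult.commute)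
  ultimately show ?thesis
    by simp
qed

lemma average_word:
  assumes "length ps + 3 * d < n" "length qs + 3 * e < n"
  shows "average n (\<lambda>z. c * word ps qs d e z) =
    (\<lambda>z. if weight_zero ps qs d e then c * word ps qs d e z else 0)"
proof
  fix z
  let ?a = "length ps + 3 * d" and ?b = "length qs + 3 * e"
  have "average n (\<lambda>z. c * word ps qs d e z) z =
      c * word ps qs d e z * (\<Sum>j<n. root1 n j ^ ?a * cnj (root1 n j) ^ ?b) / of_nat n"
    by (simp add: average_def word_rot sum_distrib_left mult_ac)
  moreover have "(\<Sum>j<n. root1 n j ^ ?a * cnj (root1 n j) ^ ?b) =
      (if weight_zero ps qs d e then of_nat n else 0)"
  proof (cases "?a = ?b")
    case True
    have "root1 n j * cnj (root1 n j) = 1" for j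
      by (simp add: complex_norm_square[symmetric] cmod_root1)
    then have "root1 n j ^ ?b * cnj (root1 n j) ^ ?b = 1" for j
      by (simp flip: power_mult_distrib)
    then show ?thesis
      using True by (simp add: weight_zero_def)
  next
    case False
    then show ?thesis
      using sum_root1_powers[OF assms] by (simp add: weight_zero_def)
  qed
  ultimately show "average n (\<lambda>z. c * word ps qs d e z) z =
      (if weight_zero ps qs d e then c * word ps qs d e z else 0)"
    using assms by simp
qed

text \<open>Once \<open>n\<close> exceeds all the exponents that occur, averaging is the projection to weight zero.\<close>

lemma average_combination:
  assumes "combination (\<lambda>_ _ _ _. True) F"
  shows "\<exists>N. \<forall>n>N. combination weight_zero (average n F)"
  using assms
proof induction
  case (scaled ps qs d e c)
  have zero: "combination weight_zero (\<lambda>z. 0)"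
    using combination.scaled[of weight_zero "[]" "[]" 0 0 0] by (simp add: weight_zero_def)
  have "combination weight_zero (average n (\<lambda>z. c * word ps qs d e z))"
    if "n > length ps + 3 * d + length qs + 3 * e" for n
    using that zero combination.scaled[of weight_zero ps qs d e c]
    by (cases "weight_zero ps qs d e") (simp_all add: average_word)
  then show ?case
    by blast
next
  case (plus F G)
  then obtain N N' where N: "\<forall>n>N. combination weight_zero (average n F)"
    "\<forall>n>N'. combination weight_zero (average n G)"
    by blast
  have "average n (\<lambda>z. F z + G z) = (\<lambda>z. average n F z + average n G z)" for n
    by (auto simp: average_def sum.distrib add_divide_distrib)
  then have "\<forall>n>max N N'. combination weight_zero (average n (\<lambda>z. F z + G z))"
    using N by (simp add: combination.plus)
  then show ?case
    by blast
qed

lemma SO2_inv_combination: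
  assumes "F \<in> SO2_invs"
  shows "combination weight_zero (\<lambda>z. of_real (F z))"
proof -
  have "combination (\<lambda>_ _ _ _. True) (\<lambda>z. of_real (F z))"
    using assms real_polynomial_combination by (simp add: SO2_invs_def)
  then obtain N where "\<forall>n>N. combination weight_zero (average n (\<lambda>z. of_real (F z)))"
    using average_combination by blast
  then have "combination weight_zero (average (Suc N) (\<lambda>z. of_real (F z)))"
    by blast
  moreover have "F (rot (root1 n j) z) = F z" for n j z
    using assms cmod_root1 unfolding SO2_invs_def by blast
  then have "average (Suc N) (\<lambda>z. of_real (F z)) = (\<lambda>z. of_real (F z))"
    by (auto simp: average_def simp del: of_nat_Suc)
  ultimately show ?thesis
    by simp
qed

section \<open>Generators of the invariants\<close>

text \<open>Up to the order of its letters, every elementary monomial belongs to the list; exchanging the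
  letters of a quadratic one conjugates it, which is the sign \<open>s\<close>. The value \<open>s = 0\<close> covers the
  monomials that are real everywhere.\<close>

lemma sorted_mono:
  obtains m' s where "RePart m' \<in> O2_idx" and "ImPart m' \<in> SO2_idx \<or> s = 0"
    and "\<And>z. Re (ev m z) = Re (ev m' z)" and "\<And>z. Im (ev m z) = s * Im (ev m' z)"
proof -
  have RePart: "RePart m' \<in> O2_idx" if "ImPart m' \<in> SO2_idx" for m'
    using that by (auto simp: SO2_idx_def O2_idx_def)
  show thesis
  proof (cases m)
    case (Quad i j)
    have "i = j \<or> ImPart (Quad i j) \<in> SO2_idx \<or> ImPart (Quad j i) \<in> SO2_idx"
      by (cases i; cases j) (auto simp: SO2_idx_def)
    then show thesis
    proof (elim disjE)
      assume "i = j"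
      moreover have "RePart (Quad i i) \<in> O2_idx"
        by (cases i) (auto simp: O2_idx_def)
      ultimately show thesis
        using that[of "Quad i i" 0] Quad by simp
    next
      assume "ImPart (Quad i j) \<in> SO2_idx"
      then show thesis
        using that[of "Quad i j" 1] Quad RePart by simp
    next
      assume "ImPart (Quad j i) \<in> SO2_idx"
      then show thesis
        using that[of "Quad j i" "-1"] Quad RePart by (simp add: algebra_simps)
    qed
  next
    case HH
    have "RePart HH \<in> O2_idx"
      by (simp add: O2_idx_def)
    then show thesis
      using that[of HH 0] HH by simp
  next
    case (Cub i j k)
    have "\<exists>m' \<in> {Cub i j k, Cub i k j, Cub j i k, Cub j k i, Cub k i j, Cub k j i}.
        ImPart m' \<in> SO2_idx"
      by (cases i; cases j; cases k) (simp_all add: SO2_idx_def)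
    then obtain m' where m': "ImPart m' \<in> SO2_idx"
      "m' \<in> {Cub i j k, Cub i k j, Cub j i k, Cub j k i, Cub k i j, Cub k j i}"
      by blast
    then have "ev m z = ev m' z" for z
      unfolding Cub by (auto simp: mult_ac)
    then show thesis
      using that[of m' 1] m' RePart by simp
  qed
qed

lemma Re_ev_mem:
  assumes "RePart m \<in> I"
  shows "(\<lambda>z. Re (ev m z)) \<in> generated_algebra UNIV (cov ` I)"
proof -
  have "cov (RePart m) \<in> generated_algebra UNIV (cov ` I)"
    using assms by (blast intro: generated_algebra.gen)
  from alg_scale[OF this, of "if m = HH then 1 / 4 else 1"] show ?thesis
    by (cases "m = HH") (simp_all del: ev.simps)
qed

lemma Im_ev_mem:
  assumes "ImPart m \<in> I"
  shows "(\<lambda>z. Im (ev m z)) \<in> generated_algebra UNIV (cov ` I)"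
proof -
  have "cov (ImPart m) \<in> generated_algebra UNIV (cov ` I)"
    using assms by (blast intro: generated_algebra.gen)
  from alg_scale[OF this, of "if m = Quad SV SW \<or> m = Cub SX SX SX then 1 else -1"] show ?thesis
    by (cases "m = Quad SV SW \<or> m = Cub SX SX SX") (simp_all del: ev.simps)
qed

abbreviation alg_SO2 :: "(model \<Rightarrow> real) set" where
  "alg_SO2 \<equiv> generated_algebra UNIV (cov ` SO2_idx)"

abbreviation alg_O2 :: "(model \<Rightarrow> real) set" where
  "alg_O2 \<equiv> generated_algebra UNIV (cov ` O2_idx)"

lemma Re_ev_alg_O2: "(\<lambda>z. Re (ev m z)) \<in> alg_O2"
proof (rule sorted_mono[of m])
  fix m' s assume "RePart m' \<in> O2_idx" "\<And>z. Re (ev m z) = Re (ev m' z)"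
  then show ?thesis
    using Re_ev_mem[of m' O2_idx] by simp
qed

lemma Re_ev_alg_SO2: "(\<lambda>z. Re (ev m z)) \<in> alg_SO2"
  using Re_ev_alg_O2 generated_algebra_mono[of "cov ` O2_idx" "cov ` SO2_idx"]
  by (auto simp: SO2_idx_def)

lemma Im_ev_alg_SO2: "(\<lambda>z. Im (ev m z)) \<in> alg_SO2"
proof (rule sorted_mono[of m])
  fix m' s assume "ImPart m' \<in> SO2_idx \<or> s = 0" and eq: "\<And>z. Im (ev m z) = s * Im (ev m' z)"
  then have "(\<lambda>z. s * Im (ev m' z)) \<in> alg_SO2"
  proof (elim disjE)
    assume "ImPart m' \<in> SO2_idx"
    then show ?thesis
      using alg_scale Im_ev_mem by blast
  next
    assume "s = 0"
    then show ?thesis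
      using alg_const[of 0] by simp
  qed
  then show ?thesis
    using eq by simp
qed

lemma word_alg_SO2:
  assumes "weight_zero ps qs d e"
  shows "(\<lambda>z. Re (word ps qs d e z)) \<in> alg_SO2 \<and> (\<lambda>z. Im (word ps qs d e z)) \<in> alg_SO2"
proof -
  define E where "E = {F. (\<lambda>z. Re (F z)) \<in> alg_SO2 \<and> (\<lambda>z. Im (F z)) \<in> alg_SO2}"
  have "(\<lambda>z. F z * G z) \<in> E" if "F \<in> E" "G \<in> E" for F G
    using that unfolding E_def by (simp add: alg_add alg_diff alg_mult)
  moreover have "ev m \<in> E" for m
    by (simp add: E_def Re_ev_alg_SO2 Im_ev_alg_SO2)
  moreover have "(\<lambda>z. cnj (ev m z)) \<in> E" for m
    using alg_scale[OF Im_ev_alg_SO2, of "-1" m]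
    by (simp add: E_def Re_ev_alg_SO2 del: ev.simps)
  moreover have "(\<lambda>z. 1) \<in> E"
    by (simp add: E_def alg_const)
  ultimately have "word ps qs d e \<in> E"
    by (intro weight_zero_word_induct assms) blast+
  then show ?thesis
    by (simp add: E_def)
qed

theorem alg_SO2_eq: "alg_SO2 = SO2_invs"
proof
  show "alg_SO2 \<subseteq> SO2_invs"
    by (rule generated_subset_SO2_invs) (auto simp: cov_SO2_inv)
  show "SO2_invs \<subseteq> alg_SO2"
  proof
    fix F assume "F \<in> SO2_invs"
    have "(\<lambda>z. Re (G z)) \<in> alg_SO2" if "combination weight_zero G" for G
      using that
    proof induction
      case (scaled ps qs d e c)
      then show ?case
        using word_alg_SO2[OF scaled] by (simp add: alg_diff alg_scale)
    next
      case (plus F G)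
      then show ?case
        by (simp add: alg_add)
    qed
    from this[OF SO2_inv_combination[OF \<open>F \<in> SO2_invs\<close>]] show "F \<in> alg_SO2"
      by simp
  qed
qed

text \<open>The product of two imaginary parts is a polynomial in the real parts. These are the identities
  of Lagrange type for a product of two determinants: with \<open>a \<bullet> b = Re (a * cnj b)\<close>, the
  determinant of \<open>a\<close> and \<open>b\<close> is \<open>- Im (a * cnj b)\<close>.\<close>

lemma Im_Quad_Quad:
  "Im (ev (Quad i j) z) * Im (ev (Quad k l) z) =
    Re (ev (Quad i k) z) * Re (ev (Quad j l) z) - Re (ev (Quad i l) z) * Re (ev (Quad j k) z)"
  by (simp add: algebra_simps)

lemma Im_Quad_Cub:
  "Im (ev (Quad i j) z) * Im (ev (Cub k l m) z) =
    Re (ev (Quad i k) z) * Re (ev (Cub j l m) z) - Re (ev (Quad j k) z) * Re (ev (Cub i l m) z)"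
  by (simp add: algebra_simps)

lemma Im_Cub_Cub:
  "Im (ev (Cub i j k) z) * Im (ev (Cub a b c) z) =
    Re (ev HH z) * Re (ev (Quad i a) z * ev (Quad j b) z * ev (Quad k c) z) -
    Re (ev (Cub i j k) z) * Re (ev (Cub a b c) z)"
proof -
  have Im_Im: "Im p * Im q = Re (p * cnj q) - Re p * Re q" for p q
    by (simp add: algebra_simps)
  have "ev (Cub i j k) z * cnj (ev (Cub a b c) z) =
      ev HH z * (ev (Quad i a) z * ev (Quad j b) z * ev (Quad k c) z)"
    by simp
  moreover have "Re (ev HH z * q) = Re (ev HH z) * Re q" for q
    by simp
  ultimately show ?thesis
    using Im_Im by presburger
qed

lemma Im_Quad_Quad_mem: "(\<lambda>z. Im (ev (Quad i j) z) * Im (ev (Quad k l) z)) \<in> alg_O2"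
  unfolding Im_Quad_Quad by (intro alg_diff alg_mult Re_ev_alg_O2)

lemma Re_Quad3_mem:
  "(\<lambda>z. Re (ev (Quad i a) z * ev (Quad j b) z * ev (Quad k c) z)) \<in> alg_O2"
proof -
  have *: "Re (p * q * r) = Re p * Re q * Re r - Im p * Im q * Re r - Im p * Im r * Re q
      - Im q * Im r * Re p" for p q r
    by (simp add: algebra_simps)
  show ?thesis
    unfolding * by (intro alg_diff alg_mult[OF Im_Quad_Quad_mem] alg_mult Re_ev_alg_O2)
qed

lemma Im_ev_Im_ev_mem: "(\<lambda>z. Im (ev m z) * Im (ev n z)) \<in> alg_O2"
proof -
  have HH: "Im (ev HH z) = 0" for z
    by simp
  have zero: "(\<lambda>z. 0) \<in> alg_O2"
    by (rule alg_const)
  have Quad_Cub: "(\<lambda>z. Im (ev (Quad i j) z) * Im (ev (Cub a b c) z)) \<in> alg_O2" for i j a b c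
    unfolding Im_Quad_Cub by (intro alg_diff alg_mult Re_ev_alg_O2)
  have Cub_Cub: "(\<lambda>z. Im (ev (Cub i j k) z) * Im (ev (Cub a b c) z)) \<in> alg_O2" for i j k a b c
    unfolding Im_Cub_Cub by (intro alg_diff alg_mult Re_ev_alg_O2 Re_Quad3_mem)
  have Cub_Quad: "(\<lambda>z. Im (ev (Cub a b c) z) * Im (ev (Quad i j) z)) \<in> alg_O2" for i j a b c
    using Quad_Cub by (simp only: mult.commute)
  show ?thesis
    by (cases m; cases n)
      (simp_all only: HH zero Im_Quad_Quad_mem Quad_Cub Cub_Cub Cub_Quad mult_zero_left mult_zero_right)
qed

text \<open>Only real parts are wanted, but the real part of a product also contains the product of the
  imaginary parts. The induction therefore carries along the product of the imaginary part with
  that of any further elementary monomial.\<close>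

lemma Re_word_alg_O2:
  assumes "weight_zero ps qs d e"
  shows "(\<lambda>z. Re (word ps qs d e z)) \<in> alg_O2"
proof -
  define E where
    "E = {F. (\<lambda>z. Re (F z)) \<in> alg_O2 \<and> (\<forall>n. (\<lambda>z. Im (F z) * Im (ev n z)) \<in> alg_O2)}"
  have mult: "(\<lambda>z. F z * G z) \<in> E"
    if F: "F \<in> E" and G: "G = ev m \<or> G = (\<lambda>z. cnj (ev m z))" for F G m
  proof -
    obtain s where s: "\<And>z. Re (G z) = Re (ev m z)" "\<And>z. Im (G z) = s * Im (ev m z)"
    proof (cases "G = ev m")
      case True
      then show thesis using that[of 1] by simp
    next
      case False
      then have "G = (\<lambda>z. cnj (ev m z))" using G by blast
      then show thesis using that[of "-1"] by (simp del: ev.simps)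
    qed
    have "Re (F z * G z) = Re (F z) * Re (ev m z) - s * (Im (F z) * Im (ev m z))" for z
      by (simp add: s algebra_simps del: ev.simps)
    moreover have "Im (F z * G z) * Im (ev n z) =
        s * (Im (ev m z) * Im (ev n z)) * Re (F z) + Im (F z) * Im (ev n z) * Re (ev m z)" for z n
      by (simp add: s algebra_simps del: ev.simps)
    ultimately show ?thesis
      using F unfolding E_def
      by (simp del: ev.simps times_complex.sel
          add: alg_diff alg_add alg_mult alg_scale Re_ev_alg_O2 Im_ev_Im_ev_mem)
  qed
  have "word ps qs d e \<in> E"
  proof (rule weight_zero_word_induct[OF _ _ _ assms])
    show "(\<lambda>z. 1) \<in> E"
      by (simp add: E_def alg_const del: ev.simps)
  qed (use mult in blast)+
  then show ?thesis
    by (simp add: E_def)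
qed

theorem alg_O2_eq: "alg_O2 = O2_invs"
proof
  show "alg_O2 \<subseteq> O2_invs"
    by (rule generated_subset_O2_invs) (auto simp: cov_O2_inv)
  show "O2_invs \<subseteq> alg_O2"
  proof
    fix F assume F: "F \<in> O2_invs"
    \<comment> \<open>A reflection conjugates every word, so averaging over it leaves the real parts only.\<close>
    have "(\<lambda>z. Re (G z) + Re (G (reflect z))) \<in> alg_O2" if "combination weight_zero G" for G
      using that
    proof induction
      case (scaled ps qs d e c)
      have "Re (c * word ps qs d e z) + Re (c * word ps qs d e (reflect z)) =
          2 * Re c * Re (word ps qs d e z)" for z
        by (simp add: word_reflect)
      then show ?case
        using alg_scale[OF Re_word_alg_O2[OF scaled], of "2 * Re c"] by presburger
    next
      case (plus G G')
      have "(\<lambda>z. Re (G z + G' z) + Re (G (reflect z) + G' (reflect z))) =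
          (\<lambda>z. (Re (G z) + Re (G (reflect z))) + (Re (G' z) + Re (G' (reflect z))))"
        by auto
      then show ?case
        using alg_add[OF plus.IH] by simp
    qed
    moreover have "combination weight_zero (\<lambda>z. of_real (F z))"
      using F by (intro SO2_inv_combination) (simp add: O2_invs_def)
    ultimately have "(\<lambda>z. F z + F (reflect z)) \<in> alg_O2"
      by fastforce
    moreover have "F (reflect z) = F z" for z
      using F by (simp add: O2_invs_def del: split_paired_All)
    ultimately show "F \<in> alg_O2"
      using alg_scale[of "\<lambda>z. F z + F (reflect z)" _ "1 / 2"] by simp
  qed
qed

section \<open>Complex coordinates\<close>

definition vecc :: "vec2 \<Rightarrow> complex" where
  "vecc v = Complex (v $ 1) (v $ 2)"

definition cvec :: "complex \<Rightarrow> vec2" where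
  "cvec z = (\<chi> i. if i = 1 then Re z else Im z)"

definition hcoord :: "ten3 \<Rightarrow> complex" where
  "hcoord H = Complex (H $ 1 $ 1 $ 1) (H $ 1 $ 1 $ 2)"

text \<open>The polarization of the cubic form \<open>z \<mapsto> Re (cnj h * z\<^sup>3)\<close>, with the basis vectors read as \<open>1\<close>
  and \<open>\<i>\<close>. It is traceless because \<open>1\<^sup>2 + \<i>\<^sup>2 = 0\<close>.\<close>

definition htens :: "complex \<Rightarrow> ten3" where
  "htens h = (\<chi> i j k. let e = \<lambda>l. if l = 1 then 1 else \<i> in Re (cnj h * e i * e j * e k))"

lemma vecc_cvec [simp]: "vecc (cvec z) = z"
  by (simp add: vecc_def cvec_def complex_eq_iff)

lemma vecc_inject: "vecc v = vecc w \<longleftrightarrow> v = w"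
  by (simp add: vecc_def vec_eq_iff forall_2)

lemma hcoord_htens [simp]: "hcoord (htens h) = h"
  by (simp add: hcoord_def htens_def complex_eq_iff)

lemma htens_in_H3: "htens h \<in> H3"
  by (simp add: htens_def H3_def forall_2 sum_2)

lemma H3_components:
  assumes "H \<in> H3"
  shows "H $ 1 $ 1 $ 1 = Re (hcoord H)" "H $ 1 $ 1 $ 2 = Im (hcoord H)"
    "H $ 1 $ 2 $ 1 = Im (hcoord H)" "H $ 2 $ 1 $ 1 = Im (hcoord H)"
    "H $ 1 $ 2 $ 2 = - Re (hcoord H)" "H $ 2 $ 1 $ 2 = - Re (hcoord H)"
    "H $ 2 $ 2 $ 1 = - Re (hcoord H)" "H $ 2 $ 2 $ 2 = - Im (hcoord H)"
proof -
  have "H $ i $ j $ k = H $ j $ i $ k" "H $ i $ j $ k = H $ i $ k $ j" for i j k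
    using assms unfolding H3_def by blast+
  from this(1)[of 2 1 1] this(1)[of 2 1 2] this(2)[of 1 2 1] this(2)[of 2 2 1]
  have "H $ 1 $ 2 $ 1 = H $ 1 $ 1 $ 2" "H $ 2 $ 1 $ 1 = H $ 1 $ 1 $ 2"
    "H $ 1 $ 2 $ 2 = H $ 2 $ 2 $ 1" "H $ 2 $ 1 $ 2 = H $ 2 $ 2 $ 1"
    by linarith+
  moreover have "H $ 1 $ 1 $ k + H $ 2 $ 2 $ k = 0" for k
    using assms unfolding H3_def sum_2 by blast
  from this[of 1] this[of 2]
  have "H $ 2 $ 2 $ 1 = - H $ 1 $ 1 $ 1" "H $ 2 $ 2 $ 2 = - H $ 1 $ 1 $ 2"
    by linarith+
  ultimately show "H $ 1 $ 1 $ 1 = Re (hcoord H)" "H $ 1 $ 1 $ 2 = Im (hcoord H)"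
    "H $ 1 $ 2 $ 1 = Im (hcoord H)" "H $ 2 $ 1 $ 1 = Im (hcoord H)"
    "H $ 1 $ 2 $ 2 = - Re (hcoord H)" "H $ 2 $ 1 $ 2 = - Re (hcoord H)"
    "H $ 2 $ 2 $ 1 = - Re (hcoord H)" "H $ 2 $ 2 $ 2 = - Im (hcoord H)"
    by (simp_all add: hcoord_def)
qed

lemma hcoord_inject: "H \<in> H3 \<Longrightarrow> K \<in> H3 \<Longrightarrow> hcoord H = hcoord K \<longleftrightarrow> H = K"
  by (auto simp: vec_eq_iff forall_2 H3_components complex_eq_iff)

text \<open>For \<open>cmod u = 1\<close>, \<open>mat2 u 1\<close> is the rotation \<open>z \<mapsto> u * z\<close> and \<open>mat2 u (-1)\<close> the reflection
  \<open>z \<mapsto> u * cnj z\<close>.\<close>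

definition mat2 :: "complex \<Rightarrow> real \<Rightarrow> ten2" where
  "mat2 u s = (\<chi> i j. if i = 1 then (if j = 1 then Re u else - s * Im u)
                       else (if j = 1 then Im u else s * Re u))"

lemma mat2_components [simp]:
  "mat2 u s $ 1 $ 1 = Re u" "mat2 u s $ 1 $ 2 = - s * Im u"
  "mat2 u s $ 2 $ 1 = Im u" "mat2 u s $ 2 $ 2 = s * Re u"
  by (simp_all add: mat2_def)

lemma mat2_in_O2:
  assumes "cmod u = 1" "s = 1 \<or> s = -1"
  shows "mat2 u s \<in> O2" "det (mat2 u s) = s"
proof -
  have u: "Re u * Re u + Im u * Im u = 1"
    using assms(1) by (simp add: cmod_def power2_eq_square)
  show "mat2 u s \<in> O2"
    using assms(2) u
    by (auto simp: O2_def orthogonal_matrix vec_eq_iff forall_2 matrix_matrix_mult_def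
        transpose_def sum_2 mat_def algebra_simps)
  have "det (mat2 u s) = s * (Re u * Re u + Im u * Im u)"
    by (simp add: det_2 algebra_simps)
  then show "det (mat2 u s) = s"
    using u by simp
qed

lemma O2_cases:
  assumes "g \<in> O2"
  obtains u s where "cmod u = 1" "s = 1 \<or> s = -1" "g = mat2 u s"
proof -
  define a b c d where "a = g $ 1 $ 1" and "b = g $ 1 $ 2" and "c = g $ 2 $ 1" and "d = g $ 2 $ 2"
  have "transpose g ** g = mat 1" "g ** transpose g = mat 1"
    using assms by (auto simp: O2_def orthogonal_matrix_def)
  then have eqs: "a * a + c * c = 1" "a * b + c * d = 0" "b * b + d * d = 1" "a * a + b * b = 1"
    by (simp_all add: vec_eq_iff forall_2 matrix_matrix_mult_def transpose_def sum_2 mat_def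
        a_def b_def c_def d_def mult.commute)
  define s where "s = a * d - b * c"
  have d: "d = s * a" and b: "b = - s * c"
    using eqs unfolding s_def by algebra+
  have "s * s = 1"
    using eqs unfolding s_def by algebra
  then have "s = 1 \<or> s = -1"
    by (simp add: square_eq_1_iff)
  moreover have "g = mat2 (Complex a c) s"
    using b d by (simp add: vec_eq_iff forall_2 mat2_def a_def b_def c_def d_def)
  moreover have "cmod (Complex a c) = 1"
    using eqs by (simp add: cmod_def power2_eq_square)
  ultimately show thesis
    using that by blast
qed

lemma vecc_mat2:
  "vecc (mat2 u 1 *v v) = u * vecc v" "vecc (mat2 u (-1) *v v) = u * cnj (vecc v)"
  by (simp_all add: vecc_def complex_eq_iff matrix_vector_mult_def sum_2)

lemma hcoord_mat2:
  assumes "H \<in> H3"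
  shows "hcoord (tensor_act (mat2 u 1) H) = u ^ 3 * hcoord H"
    "hcoord (tensor_act (mat2 u (-1)) H) = u ^ 3 * cnj (hcoord H)"
proof -
  define a where "a = hcoord H"
  note H = H3_components[OF assms, folded a_def]
  have "hcoord (tensor_act (mat2 u 1) H) = u ^ 3 * a"
    "hcoord (tensor_act (mat2 u (-1)) H) = u ^ 3 * cnj a"
    unfolding hcoord_def
    by (simp_all add: complex_eq_iff tensor_act_def sum_2 H power3_eq_cube algebra_simps)
  then show "hcoord (tensor_act (mat2 u 1) H) = u ^ 3 * hcoord H"
    "hcoord (tensor_act (mat2 u (-1)) H) = u ^ 3 * cnj (hcoord H)"
    by (simp_all add: a_def)
qed

definition psym :: "ten3 \<Rightarrow> ten3" where
  "psym P = (\<chi> i j k. (P $ i $ j $ k + P $ i $ k $ j) / 2)"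

lemma psym_in_Piez: "psym P \<in> Piez"
  by (simp add: psym_def Piez_def)

lemma psym_eq: "P \<in> Piez \<Longrightarrow> psym P = P"
  by (simp add: psym_def Piez_def vec_eq_iff)

lemma psym_add: "psym (P + Q) = psym P + psym Q"
  by (simp add: psym_def vec_eq_iff add_divide_distrib)

lemma psym_scale: "psym (c *\<^sub>R P) = c *\<^sub>R psym P"
  by (simp add: psym_def vec_eq_iff algebra_simps)

lemma tensor_act_in_Piez:
  assumes "P \<in> Piez"
  shows "tensor_act g P \<in> Piez"
proof -
  have "P $ i $ 2 $ 1 = P $ i $ 1 $ 2" for i
    using assms by (simp add: Piez_def)
  then show ?thesis
    by (simp add: Piez_def tensor_act_def forall_2 sum_2 algebra_simps)
qed

abbreviation pair_act :: "ten2 \<Rightarrow> ten3 \<times> vec2 \<Rightarrow> ten3 \<times> vec2" where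
  "pair_act g a \<equiv> (case a of (P, x) \<Rightarrow> (tensor_act g P, g *v x))"

text \<open>Symmetrizing first extends the coordinates from the representation to a linear map of the
  ambient space, where polynomials live.\<close>

definition coords :: "(ten3 \<Rightarrow> vec2 \<times> vec2 \<times> ten3) \<Rightarrow> ten3 \<times> vec2 \<Rightarrow> model" where
  "coords \<phi> = (\<lambda>(P, x). case \<phi> (psym P) of (v, w, H) \<Rightarrow> (vecc v, vecc w, vecc x, hcoord H))"

abbreviation pullback ::
  "(ten3 \<Rightarrow> vec2 \<times> vec2 \<times> ten3) \<Rightarrow> (model \<Rightarrow> real) \<Rightarrow> ten3 \<times> vec2 \<Rightarrow> real" where
  "pullback \<phi> \<equiv> lift (coords \<phi>) (Piez \<times> UNIV)"

abbreviation model_cov :: "(ten3 \<Rightarrow> vec2 \<times> vec2 \<times> ten3) \<Rightarrow> idx \<Rightarrow> ten3 \<times> vec2 \<Rightarrow> real" where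
  "model_cov \<phi> i \<equiv> pullback \<phi> (cov i)"

fun has_x :: "mono \<Rightarrow> bool" where
  "has_x (Quad i j) \<longleftrightarrow> i = SX \<or> j = SX"
| "has_x HH \<longleftrightarrow> False"
| "has_x (Cub i j k) \<longleftrightarrow> i = SX \<or> j = SX \<or> k = SX"

context
  fixes \<phi> :: "ten3 \<Rightarrow> vec2 \<times> vec2 \<times> ten3"
  assumes \<phi>: "harmonic_decomposition \<phi>"
begin

lemma \<phi>_in_H3:
  assumes "P \<in> Piez" "\<phi> P = (v, w, H)"
  shows "H \<in> H3"
proof -
  have "\<phi> P \<in> UNIV \<times> UNIV \<times> H3"
    using \<phi> assms(1) by (auto simp: harmonic_decomposition_def bij_betw_def)
  then show ?thesis
    using assms(2) by simp
qed

lemma linear_coords: "linear (coords \<phi>)"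
proof (rule linearI)
  fix a b :: "ten3 \<times> vec2" and c :: real
  obtain P x Q y where ab: "a = (P, x)" "b = (Q, y)" by fastforce
  have "\<phi> (psym (P + Q)) = \<phi> (psym P) + \<phi> (psym Q)"
    using \<phi> psym_in_Piez by (simp add: harmonic_decomposition_def psym_add)
  then show "coords \<phi> (a + b) = coords \<phi> a + coords \<phi> b"
    by (simp add: coords_def ab vecc_def hcoord_def complex_eq_iff split: prod.splits)
  have "\<phi> (psym (c *\<^sub>R P)) = c *\<^sub>R \<phi> (psym P)"
    using \<phi> psym_in_Piez by (simp add: harmonic_decomposition_def psym_scale)
  then show "coords \<phi> (c *\<^sub>R a) = c *\<^sub>R coords \<phi> a"
    by (simp add: coords_def ab vecc_def hcoord_def complex_eq_iff split: prod.splits)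
qed

lemma bij_betw_coords: "bij_betw (coords \<phi>) (Piez \<times> UNIV) UNIV"
proof -
  have bij: "bij_betw \<phi> Piez (UNIV \<times> UNIV \<times> H3)"
    using \<phi> by (simp add: harmonic_decomposition_def)
  have "inj_on (coords \<phi>) (Piez \<times> UNIV)"
  proof (rule inj_onI, clarify)
    fix P Q :: ten3 and x y :: vec2
    assume PQ: "P \<in> Piez" "Q \<in> Piez" and eq: "coords \<phi> (P, x) = coords \<phi> (Q, y)"
    obtain v w H v' w' K where vw: "\<phi> P = (v, w, H)" "\<phi> Q = (v', w', K)"
      by (metis prod_cases3)
    have "\<phi> P = \<phi> Q" and "x = y"
      using eq \<phi>_in_H3[OF PQ(1) vw(1)] \<phi>_in_H3[OF PQ(2) vw(2)]
      by (simp_all add: coords_def psym_eq PQ vw vecc_inject hcoord_inject)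
    then show "P = Q \<and> x = y"
      using PQ bij by (auto simp: bij_betw_def dest: inj_onD)
  qed
  moreover have "z \<in> coords \<phi> ` (Piez \<times> UNIV)" for z
  proof -
    obtain v w x h where z: "z = (v, w, x, h)"
      by (metis prod_cases4)
    have "(cvec v, cvec w, htens h) \<in> \<phi> ` Piez"
      using bij htens_in_H3 by (simp add: bij_betw_def)
    then obtain P where "P \<in> Piez" "\<phi> P = (cvec v, cvec w, htens h)"
      by force
    then have "coords \<phi> (P, cvec x) = z" "(P, cvec x) \<in> Piez \<times> UNIV"
      by (simp_all add: coords_def psym_eq z)
    then show ?thesis
      by (metis imageI)
  qed
  ultimately show ?thesis
    by (auto simp: bij_betw_def)
qed

lemma coords_image: "coords \<phi> ` (Piez \<times> UNIV) = UNIV"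
  using bij_betw_coords by (simp add: bij_betw_def)

lemma coords_act:
  assumes "a \<in> Piez \<times> UNIV" and u: "cmod u = 1"
  shows "coords \<phi> (pair_act (mat2 u 1) a) =
      rot u (coords \<phi> a)"
    and "coords \<phi> (pair_act (mat2 u (-1)) a) =
      rot u (reflect (coords \<phi> a))"
proof -
  obtain P x where a: "a = (P, x)" and P: "P \<in> Piez"
    using assms by auto
  obtain v w H where vw: "\<phi> P = (v, w, H)"
    by (metis prod_cases3)
  have H: "H \<in> H3"
    by (rule \<phi>_in_H3[OF P vw])
  have eqv: "\<phi> (tensor_act g P) = (g *v v, g *v w, tensor_act g H)" if "g \<in> O2" for g
    using \<phi> P that vw by (simp add: harmonic_decomposition_def)
  show "coords \<phi> (pair_act (mat2 u 1) a) =
      rot u (coords \<phi> a)"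
    using eqv[OF mat2_in_O2(1)[OF u, of 1]]
    by (simp add: a coords_def psym_eq tensor_act_in_Piez P vw vecc_mat2 hcoord_mat2 H)
  show "coords \<phi> (pair_act (mat2 u (-1)) a) =
      rot u (reflect (coords \<phi> a))"
    using eqv[OF mat2_in_O2(1)[OF u, of "-1"]]
    by (simp add: a coords_def psym_eq tensor_act_in_Piez P vw vecc_mat2 hcoord_mat2 H)
qed

lemma act_in_space:
  "a \<in> Piez \<times> UNIV \<Longrightarrow> (pair_act g a) \<in> Piez \<times> UNIV"
  by (auto simp: tensor_act_in_Piez)

lemma poly_funs_eq_lift:
  "poly_funs (Piez \<times> UNIV) = pullback \<phi> ` {F. real_polynomial_function F}"
proof (intro set_eqI iffI)
  fix f assume "f \<in> poly_funs (Piez \<times> (UNIV :: vec2 set))"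
  then obtain q where q: "real_polynomial_function q" "f = restrict q (Piez \<times> UNIV)"
    by (auto simp: poly_funs_def)
  define \<psi> where "\<psi> = inv_into (Piez \<times> UNIV) (coords \<phi>)"
  have \<psi>: "\<psi> z \<in> Piez \<times> UNIV" "coords \<phi> (\<psi> z) = z" for z
    unfolding \<psi>_def using coords_image by (metis UNIV_I inv_into_into, metis UNIV_I f_inv_into_f)
  have \<psi>_unique: "\<psi> z = a" if "a \<in> Piez \<times> UNIV" "coords \<phi> a = z" for a z
    using that bij_betw_coords \<psi> by (metis bij_betw_def inj_onD)
  have space: "subspace (Piez \<times> (UNIV :: vec2 set))"
    by (auto simp: subspace_def Piez_def zero_prod_def)
  have "linear \<psi>"
  proof (rule linearI)
    fix y z :: model and c :: real
    show "\<psi> (y + z) = \<psi> y + \<psi> z"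
      by (intro \<psi>_unique subspace_add[OF space] \<psi>(1))
        (simp add: linear_add[OF linear_coords] \<psi>(2))
    show "\<psi> (c *\<^sub>R y) = c *\<^sub>R \<psi> y"
      by (intro \<psi>_unique subspace_scale[OF space] \<psi>(1))
        (simp add: linear_scale[OF linear_coords] \<psi>(2))
  qed
  then have "real_polynomial_function (q \<circ> \<psi>)"
    by (intro real_polynomial_function_compose q(1) polynomial_function_bounded_linear
        linear_conv_bounded_linear[THEN iffD1])
  moreover have "f = pullback \<phi> (q \<circ> \<psi>)"
    using \<psi>_unique[OF _ refl] by (simp add: q(2) lift_def restrict_def fun_eq_iff)
  ultimately show "f \<in> pullback \<phi> ` {F. real_polynomial_function F}"
    by blast
next
  fix f assume "f \<in> pullback \<phi> ` {F. real_polynomial_function F}"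
  then obtain F where F: "real_polynomial_function F" "f = pullback \<phi> F"
    by blast
  have "real_polynomial_function (F \<circ> coords \<phi>)"
    by (intro real_polynomial_function_compose F(1) polynomial_function_bounded_linear
        linear_conv_bounded_linear[THEN iffD1] linear_coords)
  then show "f \<in> poly_funs (Piez \<times> UNIV)"
    using F(2) by (auto simp: lift_def poly_funs_def)
qed

lemma invariant_lift_iff:
  assumes "\<And>a. a \<in> Piez \<times> UNIV \<Longrightarrow> coords \<phi> (pair_act g a) = r (coords \<phi> a)"
  shows "(\<forall>a \<in> Piez \<times> UNIV. pullback \<phi> F (pair_act g a) =
      pullback \<phi> F a) \<longleftrightarrow> (\<forall>z. F (r z) = F z)"
proof -
  have "(\<forall>a \<in> Piez \<times> UNIV. pullback \<phi> F (pair_act g a) =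
      pullback \<phi> F a) \<longleftrightarrow> (\<forall>a \<in> Piez \<times> UNIV. F (r (coords \<phi> a)) = F (coords \<phi> a))"
    using assms act_in_space[of _ g] by (intro ball_cong refl) (simp add: lift_def)
  also have "\<dots> \<longleftrightarrow> (\<forall>z \<in> coords \<phi> ` (Piez \<times> UNIV). F (r z) = F z)"
    by blast
  finally show ?thesis
    by (simp add: coords_image)
qed

text \<open>In the coordinates, an arbitrary harmonic decomposition is indistinguishable from the complex
  model: only the linearity, the bijectivity and the equivariance of \<open>\<phi>\<close> enter.\<close>

lemma Cov_SO2_eq: "Cov SO2 tensor_act Piez = pullback \<phi> ` SO2_invs"
proof -
  have SO2: "SO2 = {mat2 u 1 | u. cmod u = 1}"
  proof (intro set_eqI iffI)
    fix g assume "g \<in> SO2"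
    then have "g \<in> O2" "det g = 1"
      by (auto simp: SO2_def O2_def)
    then obtain u s where "cmod u = 1" "s = 1 \<or> s = -1" "g = mat2 u s"
      by (metis O2_cases)
    then show "g \<in> {mat2 u 1 | u. cmod u = 1}"
      using mat2_in_O2(2)[of u s] \<open>det g = 1\<close> by auto
  next
    fix g assume "g \<in> {mat2 u 1 | u. cmod u = 1}"
    then show "g \<in> SO2"
      using mat2_in_O2[of _ 1] by (auto simp: SO2_def O2_def)
  qed
  have "(\<forall>g\<in>SO2. \<forall>a\<in>Piez \<times> UNIV. pullback \<phi> F (pair_act g a) =
      pullback \<phi> F a) \<longleftrightarrow> (\<forall>u z. cmod u = 1 \<longrightarrow> F (rot u z) = F z)" for F
    unfolding SO2 using invariant_lift_iff[OF coords_act(1)] by blast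
  then show ?thesis
    unfolding Cov_def Inv_def poly_funs_eq_lift SO2_invs_def by blast
qed

lemma Cov_O2_eq: "Cov O2 tensor_act Piez = pullback \<phi> ` O2_invs"
proof -
  have O2: "O2 = {mat2 u 1 | u. cmod u = 1} \<union> {mat2 u (-1) | u. cmod u = 1}"
    using mat2_in_O2 by (auto elim!: O2_cases)
  have "(\<forall>g\<in>O2. \<forall>a\<in>Piez \<times> UNIV. pullback \<phi> F (pair_act g a) =
      pullback \<phi> F a) \<longleftrightarrow>
      (\<forall>u z. cmod u = 1 \<longrightarrow> F (rot u z) = F z) \<and> (\<forall>z. F (reflect z) = F z)" (is "?inv \<longleftrightarrow> ?rhs") for F
  proof -
    have "?inv \<longleftrightarrow> (\<forall>u z. cmod u = 1 \<longrightarrow> F (rot u z) = F z) \<and>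
        (\<forall>u z. cmod u = 1 \<longrightarrow> F (rot u (reflect z)) = F z)"
      unfolding O2 using invariant_lift_iff[OF coords_act(1)] invariant_lift_iff[OF coords_act(2)]
      by blast
    also have "\<dots> \<longleftrightarrow> ?rhs"
      by (metis norm_one)
    finally show ?thesis .
  qed
  then show ?thesis
    unfolding Cov_def Inv_def poly_funs_eq_lift O2_invs_def SO2_invs_def by blast
qed

section \<open>The listed covariants\<close>

lemma piez_cov_eq:
  assumes "\<And>v w x H. H \<in> H3 \<Longrightarrow> form (c v w H) x = cov i (vecc v, vecc w, vecc x, hcoord H)"
  shows "piez_cov \<phi> form c = model_cov \<phi> i"
proof
  fix a :: "ten3 \<times> vec2"
  obtain P x where a: "a = (P, x)" by fastforce
  obtain v w H where vw: "\<phi> P = (v, w, H)"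
    by (metis prod_cases3)
  show "piez_cov \<phi> form c a = model_cov \<phi> i a"
  proof (cases "P \<in> Piez")
    case True
    then show ?thesis
      using assms[OF \<phi>_in_H3[OF True vw]]
      by (simp add: piez_cov_def lift_def coords_def a psym_eq vw)
  next
    case False
    then show ?thesis
      by (simp add: piez_cov_def lift_def a)
  qed
qed

lemma eps_components [simp]:
  "eps $ 1 $ 1 = 0" "eps $ 1 $ 2 = 1" "eps $ 2 $ 1 = -1" "eps $ 2 $ 2 = 0"
  by (simp_all add: eps_def)

lemma Id2_components [simp]:
  "Id2 $ 1 $ 1 = 1" "Id2 $ 1 $ 2 = 0" "Id2 $ 2 $ 1 = 0" "Id2 $ 2 $ 2 = 1"
  by (simp_all add: mat_def)

text \<open>A harmonic tensor contracts like the real part of the complex trilinear form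
  \<open>cnj h * a * b * c\<close>, so a quarter turn may be moved from one argument to another.\<close>

lemma tensor_to_complex:
  shows "v \<bullet> w = Re (vecc v * cnj (vecc w))"
    and "form0 c x = c"
    and "form1 v x = Re (vecc v * cnj (vecc x))"
    and "vecc (cross21 Id2 v) = \<i> * vecc v"
    and "cross11 v w = Im (vecc v * cnj (vecc w))"
    and "form2 Id2 x = Re (vecc x * cnj (vecc x))"
    and "H \<in> H3 \<Longrightarrow> vecc (vHw v H w) = hcoord H * cnj (vecc v * vecc w)"
    and "H \<in> H3 \<Longrightarrow> triple_dot H H = 4 * Re (hcoord H * cnj (hcoord H))"
    and "H \<in> H3 \<Longrightarrow> form2 (Hv H v) x = Re (cnj (hcoord H) * vecc v * vecc x * vecc x)"
    and "H \<in> H3 \<Longrightarrow> form3 H x = Re (cnj (hcoord H) * vecc x * vecc x * vecc x)"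
    and "H \<in> H3 \<Longrightarrow> form3 (cross23 Id2 H) x = Im (cnj (hcoord H) * vecc x * vecc x * vecc x)"
proof -
  show "v \<bullet> w = Re (vecc v * cnj (vecc w))"
    by (simp add: inner_vec_def sum_2 vecc_def)
  show "form0 c x = c"
    by (simp add: form0_def)
  show "form1 v x = Re (vecc v * cnj (vecc x))"
    by (simp add: form1_def sum_2 vecc_def)
  show "vecc (cross21 Id2 v) = \<i> * vecc v"
    by (simp add: cross21_def sum_2 vecc_def complex_eq_iff)
  show "cross11 v w = Im (vecc v * cnj (vecc w))"
    by (simp add: cross11_def sum_2 vecc_def)
  show "form2 Id2 x = Re (vecc x * cnj (vecc x))"
    by (simp add: form2_def sum_2 vecc_def)
  assume H: "H \<in> H3"
  define h where "h = hcoord H"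
  note comps = H3_components[OF H, folded h_def]
  show "vecc (vHw v H w) = hcoord H * cnj (vecc v * vecc w)"
    unfolding h_def[symmetric]
    by (simp add: vHw_def sum_2 vecc_def complex_eq_iff comps algebra_simps)
  show "triple_dot H H = 4 * Re (hcoord H * cnj (hcoord H))"
    unfolding h_def[symmetric]
    by (simp add: triple_dot_def sum_2 comps algebra_simps)
  show "form2 (Hv H v) x = Re (cnj (hcoord H) * vecc v * vecc x * vecc x)"
    unfolding h_def[symmetric]
    by (simp add: form2_def Hv_def sum_2 vecc_def comps algebra_simps)
  show "form3 H x = Re (cnj (hcoord H) * vecc x * vecc x * vecc x)"
    unfolding h_def[symmetric]
    by (simp add: form3_def sum_2 vecc_def comps algebra_simps)
  show "form3 (cross23 Id2 H) x = Im (cnj (hcoord H) * vecc x * vecc x * vecc x)"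
    unfolding h_def[symmetric]
    by (simp add: form3_def cross23_def sym3_def sum_2 vecc_def comps algebra_simps)
qed

lemma real_covariants:
  shows "piez_cov \<phi> form0 (\<lambda>v w H. v \<bullet> v) = model_cov \<phi> (RePart (Quad SV SV))"
    and "piez_cov \<phi> form0 (\<lambda>v w H. w \<bullet> w) = model_cov \<phi> (RePart (Quad SW SW))"
    and "piez_cov \<phi> form0 (\<lambda>v w H. v \<bullet> w) = model_cov \<phi> (RePart (Quad SV SW))"
    and "piez_cov \<phi> form0 (\<lambda>v w H. triple_dot H H) = model_cov \<phi> (RePart HH)"
    and "piez_cov \<phi> form0 (\<lambda>v w H. vHw v H v \<bullet> v) = model_cov \<phi> (RePart (Cub SV SV SV))"
    and "piez_cov \<phi> form0 (\<lambda>v w H. vHw v H v \<bullet> w) = model_cov \<phi> (RePart (Cub SV SV SW))"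
    and "piez_cov \<phi> form0 (\<lambda>v w H. vHw w H w \<bullet> w) = model_cov \<phi> (RePart (Cub SW SW SW))"
    and "piez_cov \<phi> form0 (\<lambda>v w H. vHw w H w \<bullet> v) = model_cov \<phi> (RePart (Cub SV SW SW))"
    and "piez_cov \<phi> form1 (\<lambda>v w H. v) = model_cov \<phi> (RePart (Quad SV SX))"
    and "piez_cov \<phi> form1 (\<lambda>v w H. w) = model_cov \<phi> (RePart (Quad SW SX))"
    and "piez_cov \<phi> form1 (\<lambda>v w H. vHw v H v) = model_cov \<phi> (RePart (Cub SV SV SX))"
    and "piez_cov \<phi> form1 (\<lambda>v w H. vHw w H w) = model_cov \<phi> (RePart (Cub SW SW SX))"
    and "piez_cov \<phi> form1 (\<lambda>v w H. vHw v H w) = model_cov \<phi> (RePart (Cub SV SW SX))"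
    and "piez_cov \<phi> form2 (\<lambda>v w H. Id2) = model_cov \<phi> (RePart (Quad SX SX))"
    and "piez_cov \<phi> form2 (\<lambda>v w H. Hv H v) = model_cov \<phi> (RePart (Cub SV SX SX))"
    and "piez_cov \<phi> form2 (\<lambda>v w H. Hv H w) = model_cov \<phi> (RePart (Cub SW SX SX))"
    and "piez_cov \<phi> form3 (\<lambda>v w H. H) = model_cov \<phi> (RePart (Cub SX SX SX))"
  by (rule piez_cov_eq, simp add: tensor_to_complex algebra_simps)+

lemma imaginary_covariants:
  shows "piez_cov \<phi> form0 (\<lambda>v w H. cross11 v w) = model_cov \<phi> (ImPart (Quad SV SW))"
    and "piez_cov \<phi> form0 (\<lambda>v w H. vHw v H v \<bullet> cross21 Id2 v) = model_cov \<phi> (ImPart (Cub SV SV SV))"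
    and "piez_cov \<phi> form0 (\<lambda>v w H. vHw v H v \<bullet> cross21 Id2 w) = model_cov \<phi> (ImPart (Cub SV SV SW))"
    and "piez_cov \<phi> form0 (\<lambda>v w H. vHw w H w \<bullet> cross21 Id2 v) = model_cov \<phi> (ImPart (Cub SV SW SW))"
    and "piez_cov \<phi> form0 (\<lambda>v w H. vHw w H w \<bullet> cross21 Id2 w) = model_cov \<phi> (ImPart (Cub SW SW SW))"
    and "piez_cov \<phi> form1 (\<lambda>v w H. cross21 Id2 v) = model_cov \<phi> (ImPart (Quad SV SX))"
    and "piez_cov \<phi> form1 (\<lambda>v w H. cross21 Id2 w) = model_cov \<phi> (ImPart (Quad SW SX))"
    and "piez_cov \<phi> form1 (\<lambda>v w H. vHw v H (cross21 Id2 v)) = model_cov \<phi> (ImPart (Cub SV SV SX))"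
    and "piez_cov \<phi> form1 (\<lambda>v w H. vHw w H (cross21 Id2 w)) = model_cov \<phi> (ImPart (Cub SW SW SX))"
    and "piez_cov \<phi> form1 (\<lambda>v w H. vHw v H (cross21 Id2 w)) = model_cov \<phi> (ImPart (Cub SV SW SX))"
    and "piez_cov \<phi> form2 (\<lambda>v w H. Hv H (cross21 Id2 v)) = model_cov \<phi> (ImPart (Cub SV SX SX))"
    and "piez_cov \<phi> form2 (\<lambda>v w H. Hv H (cross21 Id2 w)) = model_cov \<phi> (ImPart (Cub SW SX SX))"
    and "piez_cov \<phi> form3 (\<lambda>v w H. cross23 Id2 H) = model_cov \<phi> (ImPart (Cub SX SX SX))"
  by (rule piez_cov_eq, simp add: tensor_to_complex algebra_simps)+

lemma O2_basis_eq: "O2_basis \<phi> = model_cov \<phi> ` O2_idx"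
proof -
  have "O2_basis \<phi> = O2_covs \<phi> 0 \<union> O2_covs \<phi> 1 \<union> O2_covs \<phi> 2 \<union> O2_covs \<phi> 3"
    by (force simp: O2_basis_def O2_covs_def split: if_splits)
  then show ?thesis
    unfolding O2_covs_def O2_order0_def O2_order1_def O2_order2_def O2_order3_def O2_idx_def
    by (simp add: real_covariants Un_insert_left Un_insert_right) blast
qed

lemma SO2_basis_eq: "SO2_basis \<phi> = model_cov \<phi> ` SO2_idx"
proof -
  have "SO2_basis \<phi> = SO2_covs \<phi> 0 \<union> SO2_covs \<phi> 1 \<union> SO2_covs \<phi> 2 \<union> SO2_covs \<phi> 3"
    by (force simp: SO2_basis_def SO2_covs_def split: if_splits)
  then show ?thesis
    unfolding SO2_covs_def SO2_order0_def SO2_order1_def SO2_order2_def SO2_order3_def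
      SO2_idx_def O2_idx_def
    by (simp add: real_covariants imaginary_covariants Un_insert_left Un_insert_right) blast
qed

lemma homogeneous_model_cov: "homogeneous_on (Piez \<times> UNIV) (model_cov \<phi> i)"
proof -
  define deg where "deg m = (case m of Quad _ _ \<Rightarrow> 2 | HH \<Rightarrow> 2 | Cub _ _ _ \<Rightarrow> (4::nat))" for m
  have co: "co k (t *\<^sub>R z) = of_real t * co k z" for k t z
    by (cases z; cases k) (simp_all add: scaleR_conv_of_real)
  have hc: "hc (t *\<^sub>R z) = of_real t * hc z" for t z
    by (cases z) (simp add: scaleR_conv_of_real)
  have "ev m (t *\<^sub>R z) = of_real (t ^ deg m) * ev m z" for m t z
    by (cases m) (simp_all add: co hc deg_def power2_eq_square power4_eq_xxxx)
  then have "cov i (t *\<^sub>R z) = t ^ deg (mono_of i) * cov i z" for t z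
    by (cases i) (simp_all del: ev.simps)
  moreover have "t *\<^sub>R a \<in> Piez \<times> UNIV" if "a \<in> Piez \<times> UNIV" for t and a :: "ten3 \<times> vec2"
    using that by (auto simp: Piez_def)
  ultimately show ?thesis
    unfolding homogeneous_on_def
    by (intro exI[of _ "deg (mono_of i)"])
      (simp add: lift_def linear_scale[OF linear_coords] del: cov.simps)
qed

text \<open>Generators that are new with respect to all \<open>30\<close> covariants are also new with respect to a
  sublist, so one argument gives minimality for both groups.\<close>

lemma minimal_model_cov:
  assumes I: "I \<subseteq> SO2_idx"
    and A: "A = pullback \<phi> ` generated_algebra UNIV (cov ` I)"
  shows "minimal_integrity_basis (Piez \<times> UNIV) A (model_cov \<phi> ` I)" "inj_on (model_cov \<phi>) I"
proof -
  have gen: "generated_algebra (Piez \<times> UNIV) (model_cov \<phi> ` J) =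
      pullback \<phi> ` generated_algebra UNIV (cov ` J)" for J
    using generated_algebra_lift[of "Piez \<times> UNIV" "coords \<phi>" "cov ` J"] by (simp add: image_image)
  have new: "model_cov \<phi> i \<notin> generated_algebra (Piez \<times> UNIV) (model_cov \<phi> ` (I - {i}))"
    if "i \<in> I" for i
  proof -
    have "cov i \<notin> generated_algebra UNIV (cov ` (SO2_idx - {i}))"
      using cov_not_generated_by_others that I by blast
    moreover have "generated_algebra UNIV (cov ` (I - {i})) \<subseteq>
        generated_algebra UNIV (cov ` (SO2_idx - {i}))"
      using I by (intro generated_algebra_mono) blast
    ultimately show ?thesis
      unfolding gen inj_image_mem_iff[OF inj_lift[OF coords_image]] by blast
  qed
  have "finite I"
    using I finite_SO2_idx finite_subset by blast
  note basis = minimal_integrity_basis_image[where b = "model_cov \<phi>",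
      OF this homogeneous_model_cov gen[of I, folded A] new]
  show "minimal_integrity_basis (Piez \<times> UNIV) A (model_cov \<phi> ` I)"
    by (rule basis)
  show "inj_on (model_cov \<phi>) I"
    by (rule basis)
qed

lemma has_order_piez_cov:
  assumes "\<And>c x t. form c (t *\<^sub>R x) = t ^ n * form c x"
  shows "has_order Piez n (piez_cov \<phi> form c)"
  using assms by (auto simp: has_order_def piez_cov_def split: prod.splits)

lemma has_order_forms:
  "has_order Piez 0 (piez_cov \<phi> form0 c0)" "has_order Piez 1 (piez_cov \<phi> form1 c1)"
  "has_order Piez 2 (piez_cov \<phi> form2 c2)" "has_order Piez 3 (piez_cov \<phi> form3 c3)"
  by (rule has_order_piez_cov,
      simp add: form0_def form1_def form2_def form3_def sum_2 power2_eq_square power3_eq_cube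
        algebra_simps)+

text \<open>A covariant of positive order vanishes at \<open>x = 0\<close>, so it could only be of order \<open>0\<close> if it
  vanished identically.\<close>

lemma has_order_0_model_cov:
  assumes i: "i \<in> SO2_idx"
  shows "has_order Piez 0 (model_cov \<phi> i) \<longleftrightarrow> \<not> has_x (mono_of i)"
proof
  assume ord: "has_order Piez 0 (model_cov \<phi> i)"
  show "\<not> has_x (mono_of i)"
  proof
    assume x: "has_x (mono_of i)"
    have 0: "cov i (v, w, 0, h) = 0" for v w h
    proof -
      have "ev m (v, w, 0, h) = 0" if "has_x m" for m
        using that by (cases m) auto
      then show ?thesis
        using x by (cases i) (auto simp del: ev.simps)
    qed
    have "cov i (coords \<phi> (P, x)) = 0" if P: "P \<in> Piez" for P x
    proof -
      have "model_cov \<phi> i (P, 0 *\<^sub>R x) = 0 ^ 0 * model_cov \<phi> i (P, x)"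
        using ord P unfolding has_order_def by blast
      then have "cov i (coords \<phi> (P, x)) = cov i (coords \<phi> (P, 0 *\<^sub>R x))"
        using P by (simp add: lift_def del: cov.simps)
      also have "\<dots> = 0"
        using 0 by (simp add: coords_def vecc_def complex_eq_iff zero_complex.code[symmetric]
            split: prod.splits del: cov.simps)
      finally show ?thesis .
    qed
    then have "\<forall>z \<in> coords \<phi> ` (Piez \<times> UNIV). cov i z = 0"
      by (auto simp del: cov.simps)
    then have "cov i z = 0" for z
      by (simp add: coords_image del: cov.simps split_paired_All)
    then show False
      using real_or_imaginary_point[OF i] by metis
  qed
next
  assume x: "\<not> has_x (mono_of i)"
  have "cov i (v, w, y, h) = cov i (v, w, y', h)" for v w y y' h
  proof -
    have "co k (v, w, y, h) = co k (v, w, y', h)" if "k \<noteq> SX" for k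
      using that by (cases k) auto
    then have "ev m (v, w, y, h) = ev m (v, w, y', h)" if "\<not> has_x m" for m
      using that by (cases m) auto
    then show ?thesis
      using x by (cases i) (auto simp del: ev.simps)
  qed
  then have "cov i (coords \<phi> (P, t *\<^sub>R y)) = cov i (coords \<phi> (P, y))" for P t y
    by (simp add: coords_def split: prod.splits del: cov.simps)
  then show "has_order Piez 0 (model_cov \<phi> i)"
    by (simp add: has_order_def lift_def del: cov.simps)
qed

lemma card_order_0:
  assumes "I \<subseteq> SO2_idx"
  shows "card {c \<in> model_cov \<phi> ` I. has_order Piez 0 c} = card {i \<in> I. \<not> has_x (mono_of i)}"
proof -
  have "{c \<in> model_cov \<phi> ` I. has_order Piez 0 c} = model_cov \<phi> ` {i \<in> I. \<not> has_x (mono_of i)}"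
    using has_order_0_model_cov assms by blast
  moreover have "inj_on (model_cov \<phi>) {i \<in> I. \<not> has_x (mono_of i)}"
    by (rule inj_on_subset[OF minimal_model_cov(2)[OF assms refl]]) blast
  ultimately show ?thesis
    by (simp add: card_image)
qed

end

lemma card_O2_invariants: "card {i \<in> O2_idx. \<not> has_x (mono_of i)} = 8"
proof -
  have "{i \<in> O2_idx. \<not> has_x (mono_of i)} = {
      RePart (Quad SV SV), RePart (Quad SW SW), RePart (Quad SV SW), RePart HH,
      RePart (Cub SV SV SV), RePart (Cub SV SV SW), RePart (Cub SW SW SW), RePart (Cub SV SW SW)}"
    by (auto simp: O2_idx_def)
  then show ?thesis
    by simp
qed

lemma card_SO2_invariants: "card {i \<in> SO2_idx. \<not> has_x (mono_of i)} = 13"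
proof -
  have "{i \<in> SO2_idx. \<not> has_x (mono_of i)} = {i \<in> O2_idx. \<not> has_x (mono_of i)} \<union> {
      ImPart (Quad SV SW),
      ImPart (Cub SV SV SV), ImPart (Cub SV SV SW), ImPart (Cub SV SW SW), ImPart (Cub SW SW SW)}"
    by (auto simp: SO2_idx_def)
  also have "card \<dots> = card {i \<in> O2_idx. \<not> has_x (mono_of i)} + 5"
    by (subst card_Un_disjoint) (auto simp: O2_idx_def)
  finally show ?thesis
    by (simp add: card_O2_invariants)
qed

theorem corollary8p3:
  fixes \<phi> :: "ten3 \<Rightarrow> vec2 \<times> vec2 \<times> ten3"
  assumes "harmonic_decomposition \<phi>"
  shows "minimal_integrity_basis (Piez \<times> UNIV) (Cov SO2 tensor_act Piez) (SO2_basis \<phi>) \<and>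
         card (SO2_basis \<phi>) = 30 \<and>
         card {c \<in> SO2_basis \<phi>. has_order Piez 0 c} = 13 \<and>
         (\<forall>n. \<forall>c\<in>SO2_covs \<phi> n. has_order Piez n c) \<and>
         minimal_integrity_basis (Piez \<times> UNIV) (Cov O2 tensor_act Piez) (O2_basis \<phi>) \<and>
         card (O2_basis \<phi>) = 17 \<and>
         card {c \<in> O2_basis \<phi>. has_order Piez 0 c} = 8 \<and>
         (\<forall>n. \<forall>c\<in>O2_covs \<phi> n. has_order Piez n c)"
proof -
  have O2_sub: "O2_idx \<subseteq> SO2_idx"
    by (auto simp: SO2_idx_def)
  have SO2_alg: "Cov SO2 tensor_act Piez = pullback \<phi> ` alg_SO2"
    using Cov_SO2_eq[OF assms] by (simp add: alg_SO2_eq)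
  have O2_alg: "Cov O2 tensor_act Piez = pullback \<phi> ` alg_O2"
    using Cov_O2_eq[OF assms] by (simp add: alg_O2_eq)
  note SO2 = minimal_model_cov[OF assms subset_refl SO2_alg]
  note O2 = minimal_model_cov[OF assms O2_sub O2_alg]
  have "\<forall>n. \<forall>c\<in>SO2_covs \<phi> n. has_order Piez n c" "\<forall>n. \<forall>c\<in>O2_covs \<phi> n. has_order Piez n c"
    using has_order_forms[OF assms] by (auto simp: SO2_covs_def O2_covs_def)
  then show ?thesis
    using SO2 O2 card_order_0[OF assms subset_refl] card_order_0[OF assms O2_sub]
    by (simp add: SO2_basis_eq[OF assms] O2_basis_eq[OF assms] card_image card_SO2_idx card_O2_idx
        card_SO2_invariants card_O2_invariants)
qed

end
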